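(* Let $X$ be an infinite-dimensional Banach space. Let $A\subseteq\mathcal{L}(X)$ be a Banach subalgebra which contains the ideal of finite-rank operators on $X$. Then for every hyper-commutator $M\in A\otimes^\gamma A$ of $A$, the image of $M$ under the canonical algebra-morphism $$A\otimes^\gamma A\to\mathcal{L}(X)\otimes^\gamma\mathcal{L}(X)\xrightarrow{\ \Upsilon\ }\mathcal{L}(X\otimes^\gamma X)$$ is zero.
   Context: Banach spaces are over $\mathbb{C}$. $\mathcal{L}(X)$ is the Banach algebra of all bounded linear operators on $X$ with the operator norm; a Banach subalgebra is a norm-closed subalgebra. $\otimes^\gamma$ denotes the completed projective tensor product. For a Banach algebra $A$, $A\otimes^\gamma A$ is a Banach algebra with multiplication $(a\otimes b)(a'\otimes b')=aa'\otimes bb'$, and a Banach $A$-bimodule with (continuously extended) operations $c(a\otimes b)=(ca)\otimes b$ and $(a\otimes b)c=a\otimes(bc)$; these are also written $(c\otimes 1)(a\otimes b)$ and $(a\otimes b)(1\otimes c)$. An element $M\in A\otimes^\gamma A$ is a hyper-commutator for $A$ if $aM=Ma$ for all $a\in A$, i.e. $(a\otimes 1)M=M(1\otimes a)$ for all $a\in A$. The first map in the displayed composition is the one induced by the inclusion $A\subseteq\mathcal{L}(X)$ in both tensor factors. The map $\Upsilon:\mathcal{L}(X)\otimes^\gamma\mathcal{L}(X)\to\mathcal{L}(X\otimes^\gamma X)$ is the unique bounded linear operator (it is an algebra-morphism) with $[\Upsilon(T\otimes S)](x\otimes y)=T(x)\otimes S(y)$ for $T,S\in\mathcal{L}(X)$,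 $x,y\in X$. *)

theory Defs
  imports "HOL-Analysis.Analysis" "HOL-Analysis.Finite_Function_Topology"
begin

section \<open>Complex Banach spaces\<close>

class complex_vector = real_vector +
  fixes scaleC :: "complex \<Rightarrow> 'a \<Rightarrow> 'a"  (infixr \<open>*\<^sub>C\<close> 75)
  assumes scaleC_add_right: "c *\<^sub>C (x + y) = c *\<^sub>C x + c *\<^sub>C y"
    and scaleC_add_left: "(c + d) *\<^sub>C x = c *\<^sub>C x + d *\<^sub>C x"
    and scaleC_scaleC: "c *\<^sub>C d *\<^sub>C x = (c * d) *\<^sub>C x"
    and scaleC_one: "1 *\<^sub>C x = x"
    and scaleR_scaleC: "r *\<^sub>R x = complex_of_real r *\<^sub>C x"

class complex_normed_vector = complex_vector + real_normed_vector +
  assumes norm_scaleC: "norm (c *\<^sub>C x) = cmod c * norm x"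

class complex_banach = complex_normed_vector + banach

interpretation complex_vector: vector_space "scaleC :: complex \<Rightarrow> 'a \<Rightarrow> 'a::complex_vector"
  by unfold_locales (rule scaleC_add_right scaleC_add_left scaleC_scaleC scaleC_one)+

lemma bounded_linear_scaleC_right: "bounded_linear (\<lambda>x::'a::complex_normed_vector. c *\<^sub>C x)"
  by (rule bounded_linear_intro[of _ "cmod c"])
    (simp_all add: scaleC_add_right scaleR_scaleC scaleC_scaleC norm_scaleC mult.commute)

abbreviation csubspace :: "'a::complex_vector set \<Rightarrow> bool"
  where "csubspace \<equiv> complex_vector.subspace"

abbreviation cspan :: "'a::complex_vector set \<Rightarrow> 'a set"
  where "cspan \<equiv> complex_vector.span"

instantiation complex :: complex_banach
begin
definition scaleC_complex :: "complex \<Rightarrow> complex \<Rightarrow> complex"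
  where "scaleC_complex c x = c * x"
instance
  by standard (simp_all add: scaleC_complex_def algebra_simps scaleR_conv_of_real norm_mult)
end

definition finite_dimensional :: "'a::complex_vector set \<Rightarrow> bool"
  where "finite_dimensional S \<longleftrightarrow> (\<exists>F. finite F \<and> S \<subseteq> cspan F)"


section \<open>Bounded complex-linear operators\<close>

typedef (overloaded) ('a, 'b) cblinfun (\<open>(\<open>notation=\<open>infix cblinfun\<close>\<close>_ \<Rightarrow>\<^sub>C\<^sub>L /_)\<close> [22, 21] 21) =
  "{T :: 'a::complex_normed_vector \<Rightarrow>\<^sub>L 'b::complex_normed_vector. \<forall>c x. T (c *\<^sub>C x) = c *\<^sub>C T x}"
  morphisms blinfun_of_cblinfun cblinfun_of_blinfun
  by (rule exI[of _ 0]) simp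

setup_lifting type_definition_cblinfun

lift_definition cblinfun_apply :: "('a::complex_normed_vector \<Rightarrow>\<^sub>C\<^sub>L 'b::complex_normed_vector) \<Rightarrow> 'a \<Rightarrow> 'b"
  is blinfun_apply .

declare [[coercion "cblinfun_apply :: ('a::complex_normed_vector \<Rightarrow>\<^sub>C\<^sub>L 'b::complex_normed_vector) \<Rightarrow> 'a \<Rightarrow> 'b"]]

lemma cblinfun_eqI: "(\<And>x. cblinfun_apply S x = cblinfun_apply T x) \<Longrightarrow> S = T"
  by transfer (rule blinfun_eqI)

lemma Blinfun_scaleC_apply:
  fixes T :: "'a::real_normed_vector \<Rightarrow>\<^sub>L 'b::complex_normed_vector"
  shows "blinfun_apply (Blinfun (\<lambda>x. c *\<^sub>C blinfun_apply T x)) y = c *\<^sub>C blinfun_apply T y"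
  using bounded_linear_compose[OF bounded_linear_scaleC_right blinfun.bounded_linear_right]
  by (subst bounded_linear_Blinfun_apply) auto

instantiation cblinfun :: (complex_normed_vector, complex_normed_vector) complex_normed_vector
begin

lift_definition zero_cblinfun :: "'a \<Rightarrow>\<^sub>C\<^sub>L 'b" is 0 by simp
lift_definition plus_cblinfun :: "('a \<Rightarrow>\<^sub>C\<^sub>L 'b) \<Rightarrow> ('a \<Rightarrow>\<^sub>C\<^sub>L 'b) \<Rightarrow> 'a \<Rightarrow>\<^sub>C\<^sub>L 'b" is "(+)"
  by (simp add: blinfun.bilinear_simps scaleC_add_right)
lift_definition minus_cblinfun :: "('a \<Rightarrow>\<^sub>C\<^sub>L 'b) \<Rightarrow> ('a \<Rightarrow>\<^sub>C\<^sub>L 'b) \<Rightarrow> 'a \<Rightarrow>\<^sub>C\<^sub>L 'b" is "(-)"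
  by (simp add: blinfun.bilinear_simps complex_vector.scale_right_diff_distrib)
lift_definition uminus_cblinfun :: "('a \<Rightarrow>\<^sub>C\<^sub>L 'b) \<Rightarrow> 'a \<Rightarrow>\<^sub>C\<^sub>L 'b" is uminus
  by (simp add: blinfun.bilinear_simps complex_vector.scale_minus_right)
lift_definition scaleR_cblinfun :: "real \<Rightarrow> ('a \<Rightarrow>\<^sub>C\<^sub>L 'b) \<Rightarrow> 'a \<Rightarrow>\<^sub>C\<^sub>L 'b" is scaleR
  by (simp add: blinfun.bilinear_simps scaleR_scaleC scaleC_scaleC mult.commute)
lift_definition scaleC_cblinfun :: "complex \<Rightarrow> ('a \<Rightarrow>\<^sub>C\<^sub>L 'b) \<Rightarrow> 'a \<Rightarrow>\<^sub>C\<^sub>L 'b"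
  is "\<lambda>c T. Blinfun (\<lambda>x. c *\<^sub>C blinfun_apply T x)"
  by (simp add: Blinfun_scaleC_apply scaleC_scaleC mult.commute)
lift_definition norm_cblinfun :: "('a \<Rightarrow>\<^sub>C\<^sub>L 'b) \<Rightarrow> real" is norm .
lift_definition dist_cblinfun :: "('a \<Rightarrow>\<^sub>C\<^sub>L 'b) \<Rightarrow> ('a \<Rightarrow>\<^sub>C\<^sub>L 'b) \<Rightarrow> real" is dist .
definition sgn_cblinfun :: "('a \<Rightarrow>\<^sub>C\<^sub>L 'b) \<Rightarrow> 'a \<Rightarrow>\<^sub>C\<^sub>L 'b" where "sgn_cblinfun T = scaleR (inverse (norm T)) T"
definition uniformity_cblinfun :: "(('a \<Rightarrow>\<^sub>C\<^sub>L 'b) \<times> ('a \<Rightarrow>\<^sub>C\<^sub>L 'b)) filter"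
  where [code del]: "uniformity_cblinfun = (INF e\<in>{0<..}. principal {(x, y). dist x y < e})"
definition open_cblinfun :: "('a \<Rightarrow>\<^sub>C\<^sub>L 'b) set \<Rightarrow> bool"
  where [code del]: "open_cblinfun U = (\<forall>x\<in>U. \<forall>\<^sub>F (x', y) in uniformity. x' = x \<longrightarrow> y \<in> U)"

lemma scaleC_cblinfun_apply: "cblinfun_apply (c *\<^sub>C T) x = c *\<^sub>C cblinfun_apply T x"
  by transfer (rule Blinfun_scaleC_apply)

lemma cblinfun_apply_simps:
  "cblinfun_apply 0 x = 0"
  "cblinfun_apply (S + T) x = cblinfun_apply S x + cblinfun_apply T x"
  "cblinfun_apply (S - T) x = cblinfun_apply S x - cblinfun_apply T x"
  "cblinfun_apply (- T) x = - cblinfun_apply T x"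
  "cblinfun_apply (r *\<^sub>R T) x = r *\<^sub>R cblinfun_apply T x"
  by (transfer, simp add: blinfun.bilinear_simps)+

lemma norm_cblinfun_apply: "norm (cblinfun_apply T x) \<le> norm T * norm x"
  by transfer (rule norm_blinfun)

lemma norm_cblinfun_bound: "0 \<le> b \<Longrightarrow> (\<And>x. norm (cblinfun_apply T x) \<le> b * norm x) \<Longrightarrow> norm T \<le> b"
  by transfer (rule norm_blinfun_bound)

instance
proof
  fix S T U :: "'a \<Rightarrow>\<^sub>C\<^sub>L 'b" and c d :: complex and r s :: real
  show "S + T + U = S + (T + U)" "S + T = T + S" "0 + S = S" "- S + S = 0" "S - T = S + - T"
    "r *\<^sub>R (S + T) = r *\<^sub>R S + r *\<^sub>R T" "(r + s) *\<^sub>R S = r *\<^sub>R S + s *\<^sub>R S"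
    "r *\<^sub>R s *\<^sub>R S = (r * s) *\<^sub>R S" "1 *\<^sub>R S = S"
    by (rule cblinfun_eqI; simp add: cblinfun_apply_simps scaleR_add_right scaleR_add_left)+
  show "c *\<^sub>C (S + T) = c *\<^sub>C S + c *\<^sub>C T" "(c + d) *\<^sub>C S = c *\<^sub>C S + d *\<^sub>C S"
    "c *\<^sub>C d *\<^sub>C S = (c * d) *\<^sub>C S" "1 *\<^sub>C S = S" "r *\<^sub>R S = complex_of_real r *\<^sub>C S"
    by (rule cblinfun_eqI; simp add: cblinfun_apply_simps scaleC_cblinfun_apply
        scaleC_add_right scaleC_add_left scaleC_scaleC scaleC_one scaleR_scaleC)+
  show "dist S T = norm (S - T)"
    by transfer (rule dist_norm)
  show "(norm S = 0) = (S = 0)"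
    by transfer simp
  show "norm (S + T) \<le> norm S + norm T"
    by transfer (rule norm_triangle_ineq)
  show "norm (r *\<^sub>R S) = \<bar>r\<bar> * norm S"
    by transfer simp
  have le: "norm (c *\<^sub>C T) \<le> cmod c * norm T" for c and T :: "'a \<Rightarrow>\<^sub>C\<^sub>L 'b"
  proof (rule norm_cblinfun_bound)
    show "norm ((c *\<^sub>C T) x) \<le> cmod c * norm T * norm x" for x
      using norm_cblinfun_apply[of T x]
      by (simp add: scaleC_cblinfun_apply norm_scaleC mult_left_mono mult.assoc)
    have "0 \<le> norm T" by transfer simp
    then show "0 \<le> cmod c * norm T" by simp
  qed
  show "norm (c *\<^sub>C S) = cmod c * norm S"
  proof (cases "c = 0")
    case True
    have "c *\<^sub>C S = 0"
      by (rule cblinfun_eqI) (simp add: True scaleC_cblinfun_apply cblinfun_apply_simps)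
    then show ?thesis using True by (simp, transfer, simp)
  next
    case False
    have "inverse c *\<^sub>C c *\<^sub>C S = S"
      by (rule cblinfun_eqI) (simp add: False scaleC_cblinfun_apply)
    then have "norm S \<le> cmod (inverse c) * norm (c *\<^sub>C S)"
      using le[of "inverse c" "c *\<^sub>C S"] by simp
    then have "cmod c * norm S \<le> norm (c *\<^sub>C S)"
      using False by (simp add: norm_divide field_simps)
    with le[of c S] show ?thesis by simp
  qed
qed (simp_all add: sgn_cblinfun_def uniformity_cblinfun_def open_cblinfun_def)

end

lemma cblinfun_scaleC_right: "cblinfun_apply T (c *\<^sub>C x) = c *\<^sub>C cblinfun_apply T x"
  by transfer simp

lemma bounded_linear_cblinfun_apply: "bounded_linear (cblinfun_apply T)"
  by transfer (rule blinfun.bounded_linear_right)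

lemma cblinfun_apply_add: "cblinfun_apply T (x + y) = cblinfun_apply T x + cblinfun_apply T y"
  by (rule linear_add[OF bounded_linear.linear[OF bounded_linear_cblinfun_apply]])

lemma ex_cblinfun:
  assumes "\<And>x y. f (x + y) = f x + f y" "\<And>c x. f (c *\<^sub>C x) = c *\<^sub>C f x"
    and "\<And>x. norm (f x) \<le> K * norm x"
  shows "\<exists>T. cblinfun_apply T = f"
proof -
  have "bounded_linear f"
    by (rule bounded_linear_intro[of _ K]) (simp_all add: assms scaleR_scaleC mult.commute)
  then have ap: "blinfun_apply (Blinfun f) = f"
    by (rule bounded_linear_Blinfun_apply)
  have "cblinfun_apply (cblinfun_of_blinfun (Blinfun f)) = f"
    using ap assms(2) by (simp add: cblinfun_apply.rep_eq cblinfun_of_blinfun_inverse)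
  then show ?thesis ..
qed

instance cblinfun :: (complex_normed_vector, complex_banach) complex_banach
proof
  fix X :: "nat \<Rightarrow> 'a \<Rightarrow>\<^sub>C\<^sub>L 'b" assume "Cauchy X"
  define Y where "Y n = blinfun_of_cblinfun (X n)" for n
  have YX: "dist (Y m) (Y n) = dist (X m) (X n)" for m n
    by (simp add: Y_def dist_cblinfun.rep_eq)
  have "Cauchy Y"
    using \<open>Cauchy X\<close> by (simp add: Cauchy_def YX)
  then obtain L where L: "Y \<longlonglongrightarrow> L"
    by (metis Cauchy_convergent_iff convergent_def)
  have lim: "(\<lambda>n. Y n x) \<longlonglongrightarrow> L x" for x
    by (intro blinfun.tendsto L tendsto_const)
  have "L (c *\<^sub>C x) = c *\<^sub>C L x" for c x
  proof (rule LIMSEQ_unique[OF lim])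
    from bounded_linear.tendsto[OF bounded_linear_scaleC_right lim[of x]]
    show "(\<lambda>n. Y n (c *\<^sub>C x)) \<longlonglongrightarrow> c *\<^sub>C L x"
      using blinfun_of_cblinfun[of "X _"] by (simp add: Y_def)
  qed
  then have eq: "blinfun_of_cblinfun (cblinfun_of_blinfun L) = L"
    by (simp add: cblinfun_of_blinfun_inverse)
  have "X \<longlonglongrightarrow> cblinfun_of_blinfun L"
    using L by (simp add: lim_sequentially dist_cblinfun.rep_eq eq Y_def)
  then show "convergent X" by (auto simp: convergent_def)
qed

lift_definition cblinfun_compose ::
  "('b::complex_normed_vector \<Rightarrow>\<^sub>C\<^sub>L 'c::complex_normed_vector) \<Rightarrow> ('a::complex_normed_vector \<Rightarrow>\<^sub>C\<^sub>L 'b) \<Rightarrow> 'a \<Rightarrow>\<^sub>C\<^sub>L 'c"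
  (infixl \<open>o\<^sub>C\<^sub>L\<close> 67) is "(o\<^sub>L)"
  by simp

lemma cblinfun_compose_apply: "cblinfun_apply (S o\<^sub>C\<^sub>L T) x = cblinfun_apply S (cblinfun_apply T x)"
  by transfer simp

definition banach_subalgebra :: "('x::complex_banach \<Rightarrow>\<^sub>C\<^sub>L 'x) set \<Rightarrow> bool"
  where "banach_subalgebra A \<longleftrightarrow> csubspace A \<and> (\<forall>S\<in>A. \<forall>T\<in>A. S o\<^sub>C\<^sub>L T \<in> A) \<and> closed A"

definition finite_rank :: "('x::complex_normed_vector \<Rightarrow>\<^sub>C\<^sub>L 'x) \<Rightarrow> bool"
  where "finite_rank T \<longleftrightarrow> finite_dimensional (range (cblinfun_apply T))"


section \<open>Formal sums and the algebraic tensor product\<close>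

type_synonym ('a, 'b) formal_sum = "('a \<times> 'b) \<Rightarrow>\<^sub>0 complex"

instantiation poly_mapping :: (type, complex_vector) complex_vector
begin

definition scaleC_poly_mapping :: "complex \<Rightarrow> ('a \<Rightarrow>\<^sub>0 'b) \<Rightarrow> 'a \<Rightarrow>\<^sub>0 'b"
  where "scaleC_poly_mapping c u = Poly_Mapping.map (scaleC c) u"

lemma lookup_scaleC: "Poly_Mapping.lookup (c *\<^sub>C u) k = c *\<^sub>C Poly_Mapping.lookup u k"
  by (simp add: scaleC_poly_mapping_def Poly_Mapping.map.rep_eq when_def)

lemma lookup_scaleR': "Poly_Mapping.lookup (r *\<^sub>R u) k = r *\<^sub>R Poly_Mapping.lookup u k"
proof -
  have "finite {i. r *\<^sub>R Poly_Mapping.lookup u i \<noteq> 0}"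
    by (rule finite_subset[OF _ finite_lookup[of u]]) auto
  then show ?thesis by (simp add: scaleR_poly_mapping_def)
qed

instance
  by standard (rule poly_mapping_eqI; simp add: lookup_scaleC lookup_scaleR' lookup_add
      scaleC_add_right scaleC_add_left scaleC_scaleC scaleC_one scaleR_scaleC)+

end

definition linear_extension :: "('k \<Rightarrow> 'v::complex_vector) \<Rightarrow> ('k \<Rightarrow>\<^sub>0 complex) \<Rightarrow> 'v"
  where "linear_extension f u = (\<Sum>k\<in>Poly_Mapping.keys u. Poly_Mapping.lookup u k *\<^sub>C f k)"

lemma linear_extension_superset:
  assumes "finite S" "Poly_Mapping.keys u \<subseteq> S"
  shows "linear_extension f u = (\<Sum>k\<in>S. Poly_Mapping.lookup u k *\<^sub>C f k)"
  unfolding linear_extension_def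
  by (rule sum.mono_neutral_left) (use assms in \<open>auto simp: in_keys_iff\<close>)

lemma linear_extension_add: "linear_extension f (u + v) = linear_extension f u + linear_extension f v"
proof -
  let ?S = "Poly_Mapping.keys u \<union> Poly_Mapping.keys v"
  have "Poly_Mapping.keys (u + v) \<subseteq> ?S" by (rule Poly_Mapping.keys_add)
  then show ?thesis
    by (simp add: linear_extension_superset[of ?S] lookup_add scaleC_add_left sum.distrib)
qed

lemma linear_extension_scaleC: "linear_extension f (c *\<^sub>C u) = c *\<^sub>C linear_extension f u"
proof -
  have "Poly_Mapping.keys (c *\<^sub>C u) \<subseteq> Poly_Mapping.keys u"
    by (auto simp: in_keys_iff lookup_scaleC)
  then show ?thesis
    by (simp add: linear_extension_superset[of "Poly_Mapping.keys u"] lookup_scaleC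
        complex_vector.scale_sum_right scaleC_scaleC scaleC_complex_def)
qed

lemma linear_extension_0 [simp]: "linear_extension f 0 = 0"
  by (simp add: linear_extension_def)

lemma linear_extension_diff: "linear_extension f (u - v) = linear_extension f u - linear_extension f v"
  using linear_extension_add[of f "u - v" v] by simp

lemma linear_extension_single [simp]: "linear_extension f (Poly_Mapping.single k c) = c *\<^sub>C f k"
  by (cases "c = 0") (simp_all add: linear_extension_def)

lemma linear_extension_single_id: "linear_extension (\<lambda>k. Poly_Mapping.single k 1) u = u"
proof (rule poly_mapping_eqI)
  fix k
  have "Poly_Mapping.lookup (linear_extension (\<lambda>k. Poly_Mapping.single k 1) u) k
      = (\<Sum>i\<in>Poly_Mapping.keys u. if i = k then Poly_Mapping.lookup u i else 0)"
    unfolding linear_extension_def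
    by (simp add: lookup_sum lookup_scaleC lookup_single scaleC_complex_def when_def if_distrib cong: if_cong)
  also have "\<dots> = Poly_Mapping.lookup u k"
    by (simp add: in_keys_iff)
  finally show "Poly_Mapping.lookup (linear_extension (\<lambda>k. Poly_Mapping.single k 1) u) k
      = Poly_Mapping.lookup u k" .
qed

definition formal_tensor :: "'a \<Rightarrow> 'b \<Rightarrow> ('a, 'b) formal_sum"
  where "formal_tensor a b = Poly_Mapping.single (a, b) 1"

definition formal_sums :: "'a set \<Rightarrow> 'b set \<Rightarrow> ('a, 'b) formal_sum set"
  where "formal_sums A B = {u. Poly_Mapping.keys u \<subseteq> A \<times> B}"

definition bilinear_relators ::
  "'a::complex_vector set \<Rightarrow> 'b::complex_vector set \<Rightarrow> ('a, 'b) formal_sum set"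
  where "bilinear_relators A B =
      {formal_tensor (a + a') b - formal_tensor a b - formal_tensor a' b |a a' b. a \<in> A \<and> a' \<in> A \<and> b \<in> B}
    \<union> {formal_tensor a (b + b') - formal_tensor a b - formal_tensor a b' |a b b'. a \<in> A \<and> b \<in> B \<and> b' \<in> B}
    \<union> {formal_tensor (c *\<^sub>C a) b - c *\<^sub>C formal_tensor a b |c a b. a \<in> A \<and> b \<in> B}
    \<union> {formal_tensor a (c *\<^sub>C b) - c *\<^sub>C formal_tensor a b |c a b. a \<in> A \<and> b \<in> B}"

text \<open>
  The algebraic tensor product of two subspaces \<open>A\<close> and \<open>B\<close> is the quotient of \<open>formal_sums A B\<close>,
  the free complex vector space on \<open>A \<times> B\<close>, by \<open>tensor_null A B\<close>.  The relators depend on \<open>A\<close> and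
  \<open>B\<close> (and so does the norm below), so that nothing is borrowed from the ambient spaces.
\<close>

definition tensor_null ::
  "'a::complex_vector set \<Rightarrow> 'b::complex_vector set \<Rightarrow> ('a, 'b) formal_sum set"
  where "tensor_null A B = cspan (bilinear_relators A B)"

text \<open>The projective norm: the infimum of \<open>\<Sum> \<parallel>a\<^sub>i\<parallel> \<parallel>b\<^sub>i\<parallel>\<close> over all representations \<open>u = \<Sum> a\<^sub>i \<otimes> b\<^sub>i\<close>.\<close>

definition represents ::
  "'a::complex_vector set \<Rightarrow> 'b::complex_vector set \<Rightarrow> ('a, 'b) formal_sum \<Rightarrow> ('a \<times> 'b) list \<Rightarrow> bool"
  where "represents A B u xs \<longleftrightarrow>
    set xs \<subseteq> A \<times> B \<and> u - (\<Sum>(a, b)\<leftarrow>xs. formal_tensor a b) \<in> tensor_null A B"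

definition proj_norm ::
  "'a::complex_normed_vector set \<Rightarrow> 'b::complex_normed_vector set \<Rightarrow> ('a, 'b) formal_sum \<Rightarrow> real"
  where "proj_norm A B u = (INF xs\<in>{xs. represents A B u xs}. \<Sum>(a, b)\<leftarrow>xs. norm a * norm b)"

lemma csubspace_formal_sums: "csubspace (formal_sums A B)"
proof (rule complex_vector.subspaceI)
  show "u + v \<in> formal_sums A B" if "u \<in> formal_sums A B" "v \<in> formal_sums A B" for u v
    using that Poly_Mapping.keys_add[of u v] by (auto simp: formal_sums_def)
  show "c *\<^sub>C u \<in> formal_sums A B" if "u \<in> formal_sums A B" for c u
    using that by (auto simp: formal_sums_def in_keys_iff lookup_scaleC)
qed (simp add: formal_sums_def)

lemmas formal_sums_add = complex_vector.subspace_add[OF csubspace_formal_sums]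
  and formal_sums_diff = complex_vector.subspace_diff[OF csubspace_formal_sums]
  and formal_sums_scaleC = complex_vector.subspace_scale[OF csubspace_formal_sums]
  and formal_sums_0 = complex_vector.subspace_0[OF csubspace_formal_sums]

lemma formal_sums_UNIV [simp]: "u \<in> formal_sums UNIV UNIV"
  by (simp add: formal_sums_def)

lemma formal_tensor_in: "a \<in> A \<Longrightarrow> b \<in> B \<Longrightarrow> formal_tensor a b \<in> formal_sums A B"
  by (simp add: formal_tensor_def formal_sums_def)

lemmas tensor_null_add = complex_vector.span_add[of _ "bilinear_relators A B" for A B, folded tensor_null_def]
  and tensor_null_diff = complex_vector.span_diff[of _ "bilinear_relators A B" for A B, folded tensor_null_def]
  and tensor_null_scaleC = complex_vector.span_scale[of _ "bilinear_relators A B" for A B, folded tensor_null_def]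
  and tensor_null_base = complex_vector.span_base[of _ "bilinear_relators A B" for A B, folded tensor_null_def]

lemma tensor_null_0: "0 \<in> tensor_null A B"
  by (simp add: tensor_null_def complex_vector.span_zero)

lemma represents_0: "represents A B 0 []"
  by (simp add: represents_def tensor_null_0)

lemma represents_add:
  assumes "represents A B u xs" "represents A B v ys"
  shows "represents A B (u + v) (xs @ ys)"
  using assms tensor_null_add[of "u - (\<Sum>(a, b)\<leftarrow>xs. formal_tensor a b)" A B "v - (\<Sum>(a, b)\<leftarrow>ys. formal_tensor a b)"]
  by (simp add: represents_def algebra_simps)

lemma represents_scaleC:
  assumes A: "csubspace A" and u: "represents A B u xs"
  shows "represents A B (c *\<^sub>C u) (map (\<lambda>(a, b). (c *\<^sub>C a, b)) xs)"
proof -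
  let ?f = "\<lambda>ys. \<Sum>(a, b)\<leftarrow>ys. formal_tensor a b" and ?m = "map (\<lambda>(a, b). (c *\<^sub>C a, b))"
  have *: "?f (?m ys) - c *\<^sub>C ?f ys \<in> tensor_null A B" if "set ys \<subseteq> A \<times> B" for ys
    using that
  proof (induction ys)
    case Nil
    show ?case by (simp add: tensor_null_0)
  next
    case (Cons y ys)
    obtain a b where y: "y = (a, b)" by (cases y)
    have "formal_tensor (c *\<^sub>C a) b - c *\<^sub>C formal_tensor a b \<in> tensor_null A B"
      using Cons.prems by (intro tensor_null_base) (auto simp: y bilinear_relators_def)
    from tensor_null_add[OF this Cons.IH] Cons.prems show ?case
      by (simp add: y scaleC_add_right algebra_simps)
  qed
  have "c *\<^sub>C (u - ?f xs) - (?f (?m xs) - c *\<^sub>C ?f xs) \<in> tensor_null A B"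
    using u tensor_null_diff[OF tensor_null_scaleC * ] by (simp add: represents_def)
  moreover have "set (?m xs) \<subseteq> A \<times> B"
    using u complex_vector.subspace_scale[OF A] by (auto simp: represents_def)
  ultimately show ?thesis
    by (simp add: represents_def complex_vector.scale_right_diff_distrib)
qed

lemma represents_formal_tensor: "a \<in> A \<Longrightarrow> b \<in> B \<Longrightarrow> represents A B (formal_tensor a b) [(a, b)]"
  by (simp add: represents_def tensor_null_0)

lemma represents_cong: "u - v \<in> tensor_null A B \<Longrightarrow> represents A B u xs \<Longrightarrow> represents A B v xs"
  using tensor_null_diff[of "u - (\<Sum>(a, b)\<leftarrow>xs. formal_tensor a b)" A B "u - v"]
  by (simp add: represents_def)

lemma ex_represents:
  assumes A: "csubspace A" and u: "u \<in> formal_sums A B"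
  shows "\<exists>xs. represents A B u xs"
proof -
  have "\<exists>xs. represents A B (\<Sum>k\<in>S. Poly_Mapping.lookup u k *\<^sub>C Poly_Mapping.single k 1) xs"
    if "finite S" "S \<subseteq> A \<times> B" for S
    using that
  proof (induction S rule: finite_induct)
    case empty
    show ?case using represents_0 by auto
  next
    case (insert k S)
    obtain a b where k: "k = (a, b)" by (cases k)
    have "represents A B (Poly_Mapping.single k 1) [(a, b)]"
      using insert.prems represents_formal_tensor[of a A b B] by (simp add: k formal_tensor_def)
    from represents_scaleC[OF A this] represents_add insert show ?case
      by (metis (no_types, lifting) insert_subset sum.insert)
  qed
  from this[of "Poly_Mapping.keys u"] u show ?thesis
    using linear_extension_single_id[of u] by (simp add: formal_sums_def linear_extension_def)
qed

lemma cost_nonneg: "0 \<le> (\<Sum>(a, b)\<leftarrow>xs. norm a * norm b)"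
  by (induction xs) auto

lemma proj_norm_le:
  assumes "represents A B u xs"
  shows "proj_norm A B u \<le> (\<Sum>(a, b)\<leftarrow>xs. norm a * norm b)"
  unfolding proj_norm_def
  by (rule cINF_lower) (use assms cost_nonneg in \<open>auto intro!: bdd_belowI2[where m = 0]\<close>)

lemma le_proj_norm:
  assumes "csubspace A" "u \<in> formal_sums A B"
    and "\<And>xs. represents A B u xs \<Longrightarrow> z \<le> (\<Sum>(a, b)\<leftarrow>xs. norm a * norm b)"
  shows "z \<le> proj_norm A B u"
  unfolding proj_norm_def
  by (rule cINF_greatest) (use assms ex_represents in auto)

lemma proj_norm_nonneg: "csubspace A \<Longrightarrow> u \<in> formal_sums A B \<Longrightarrow> 0 \<le> proj_norm A B u"
  by (rule le_proj_norm) (auto simp: cost_nonneg)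

lemma proj_norm_approx:
  assumes "csubspace A" "u \<in> formal_sums A B" "0 < e"
  shows "\<exists>xs. represents A B u xs \<and> (\<Sum>(a, b)\<leftarrow>xs. norm a * norm b) < proj_norm A B u + e"
  using le_proj_norm[OF assms(1,2), of "proj_norm A B u + e"] assms(3) by force

lemma proj_norm_formal_tensor:
  "a \<in> A \<Longrightarrow> b \<in> B \<Longrightarrow> proj_norm A B (formal_tensor a b) \<le> norm a * norm b"
  using proj_norm_le[OF represents_formal_tensor] by fastforce

lemma proj_norm_cong: "u - v \<in> tensor_null A B \<Longrightarrow> proj_norm A B u = proj_norm A B v"
proof -
  assume uv: "u - v \<in> tensor_null A B"
  then have "v - u \<in> tensor_null A B"
    using tensor_null_diff[OF tensor_null_0[of A B] uv] by simp
  with uv have "represents A B u = represents A B v"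
    using represents_cong by (intro ext) blast
  then show ?thesis by (simp add: proj_norm_def)
qed

lemma proj_norm_0: "csubspace A \<Longrightarrow> proj_norm A B 0 = 0"
  using proj_norm_le[OF represents_0, of A B] proj_norm_nonneg[of A 0 B]
  by (simp add: formal_sums_0)

lemma proj_norm_null: "csubspace A \<Longrightarrow> u \<in> tensor_null A B \<Longrightarrow> proj_norm A B u = 0"
  using proj_norm_cong[of u 0 A B] by (simp add: proj_norm_0)

lemma proj_norm_triangle:
  assumes A: "csubspace A" and u: "u \<in> formal_sums A B" and v: "v \<in> formal_sums A B"
  shows "proj_norm A B (u + v) \<le> proj_norm A B u + proj_norm A B v"
proof (rule field_le_epsilon)
  fix e :: real assume "0 < e"
  then obtain xs ys where "represents A B u xs" "(\<Sum>(a, b)\<leftarrow>xs. norm a * norm b) < proj_norm A B u + e / 2"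
    "represents A B v ys" "(\<Sum>(a, b)\<leftarrow>ys. norm a * norm b) < proj_norm A B v + e / 2"
    using proj_norm_approx[OF A u, of "e / 2"] proj_norm_approx[OF A v, of "e / 2"] by auto
  then show "proj_norm A B (u + v) \<le> proj_norm A B u + proj_norm A B v + e"
    using proj_norm_le[OF represents_add, of A B u xs v ys] by simp
qed

lemma proj_norm_scaleC_le:
  assumes A: "csubspace A" and u: "u \<in> formal_sums A B"
  shows "proj_norm A B (c *\<^sub>C u) \<le> cmod c * proj_norm A B u"
proof (cases "c = 0")
  case True
  then show ?thesis by (simp add: proj_norm_0[OF A])
next
  case False
  have "proj_norm A B (c *\<^sub>C u) / cmod c \<le> proj_norm A B u"
  proof (rule le_proj_norm[OF A u])
    fix xs assume xs: "represents A B u xs"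
    have "proj_norm A B (c *\<^sub>C u) \<le> (\<Sum>(a, b)\<leftarrow>map (\<lambda>(a, b). (c *\<^sub>C a, b)) xs. norm a * norm b)"
      by (rule proj_norm_le[OF represents_scaleC[OF A xs]])
    also have "\<dots> = cmod c * (\<Sum>(a, b)\<leftarrow>xs. norm a * norm b)"
      by (induction xs) (auto simp: norm_scaleC algebra_simps)
    finally show "proj_norm A B (c *\<^sub>C u) / cmod c \<le> (\<Sum>(a, b)\<leftarrow>xs. norm a * norm b)"
      using False by (simp add: divide_le_eq mult.commute)
  qed
  then show ?thesis using False by (simp add: divide_le_eq mult.commute)
qed

lemma proj_norm_scaleC:
  assumes A: "csubspace A" and u: "u \<in> formal_sums A B"
  shows "proj_norm A B (c *\<^sub>C u) = cmod c * proj_norm A B u"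
proof (rule antisym[OF proj_norm_scaleC_le[OF A u]])
  show "cmod c * proj_norm A B u \<le> proj_norm A B (c *\<^sub>C u)"
  proof (cases "c = 0")
    case True
    then show ?thesis by (simp add: proj_norm_0[OF A])
  next
    case False
    have "proj_norm A B (inverse c *\<^sub>C c *\<^sub>C u) \<le> cmod (inverse c) * proj_norm A B (c *\<^sub>C u)"
      by (rule proj_norm_scaleC_le[OF A formal_sums_scaleC[OF u]])
    with False show ?thesis by (simp add: norm_divide field_simps)
  qed
qed

lemma proj_norm_minus: "csubspace A \<Longrightarrow> u \<in> formal_sums A B \<Longrightarrow> proj_norm A B (- u) = proj_norm A B u"
  using proj_norm_scaleC[of A u B "- 1"] by simp

lemma proj_norm_minus_commute:
  "csubspace A \<Longrightarrow> u \<in> formal_sums A B \<Longrightarrow> v \<in> formal_sums A B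
    \<Longrightarrow> proj_norm A B (u - v) = proj_norm A B (v - u)"
  using proj_norm_minus[of A "u - v" B] by (simp add: formal_sums_diff)

lemma linear_extension_null:
  assumes "u \<in> tensor_null A B" "csubspace N"
    and "\<And>r. r \<in> bilinear_relators A B \<Longrightarrow> linear_extension f r \<in> N"
  shows "linear_extension f u \<in> N"
  using assms(1) unfolding tensor_null_def
proof (rule complex_vector.span_induct)
  show "csubspace {u. linear_extension f u \<in> N}"
    using assms(2) by (auto intro!: complex_vector.subspaceI
        simp: linear_extension_add linear_extension_scaleC complex_vector.subspace_0
          complex_vector.subspace_add complex_vector.subspace_scale)
qed (simp add: assms(3))

lemma linear_extension_formal_tensor [simp]: "linear_extension f (formal_tensor a b) = f (a, b)"
  by (simp add: formal_tensor_def scaleC_one)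

lemma linear_extension_sum_list:
  "linear_extension f (\<Sum>(a, b)\<leftarrow>xs. formal_tensor a b) = (\<Sum>x\<leftarrow>xs. f x)"
  by (induction xs) (auto simp: linear_extension_add)

definition bilinear_on ::
  "'a::complex_vector set \<Rightarrow> 'b::complex_vector set \<Rightarrow> ('a \<Rightarrow> 'b \<Rightarrow> 'v::complex_vector) \<Rightarrow> bool"
  where "bilinear_on A B h \<longleftrightarrow>
    (\<forall>a\<in>A. \<forall>a'\<in>A. \<forall>b\<in>B. h (a + a') b = h a b + h a' b) \<and>
    (\<forall>a\<in>A. \<forall>b\<in>B. \<forall>b'\<in>B. h a (b + b') = h a b + h a b') \<and>
    (\<forall>c. \<forall>a\<in>A. \<forall>b\<in>B. h (c *\<^sub>C a) b = c *\<^sub>C h a b \<and> h a (c *\<^sub>C b) = c *\<^sub>C h a b)"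

lemma linear_extension_bilinear_null:
  assumes "bilinear_on A B h" "u \<in> tensor_null A B"
  shows "linear_extension (\<lambda>(a, b). h a b) u = 0"
proof -
  have "linear_extension (\<lambda>(a, b). h a b) u \<in> {0}"
  proof (rule linear_extension_null[OF assms(2) complex_vector.subspace_single_0])
    show "linear_extension (\<lambda>(a, b). h a b) r \<in> {0}" if "r \<in> bilinear_relators A B" for r
      using that assms(1)
      by (auto simp: bilinear_relators_def bilinear_on_def linear_extension_diff linear_extension_scaleC)
  qed
  then show ?thesis by simp
qed

lemma norm_linear_extension_le:
  fixes h :: "'a::complex_normed_vector \<Rightarrow> 'b::complex_normed_vector \<Rightarrow> 'v::complex_normed_vector"
  assumes A: "csubspace A" and u: "u \<in> formal_sums A B" and h: "bilinear_on A B h"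
    and K: "0 \<le> K" "\<And>a b. a \<in> A \<Longrightarrow> b \<in> B \<Longrightarrow> norm (h a b) \<le> K * (norm a * norm b)"
  shows "norm (linear_extension (\<lambda>(a, b). h a b) u) \<le> K * proj_norm A B u"
proof -
  have sum_le: "norm (\<Sum>(a, b)\<leftarrow>xs. h a b) \<le> K * (\<Sum>(a, b)\<leftarrow>xs. norm a * norm b)"
    if "set xs \<subseteq> A \<times> B" for xs
    using that
  proof (induction xs)
    case (Cons x xs)
    obtain a b where x: "x = (a, b)" by (cases x)
    have "norm (h a b + (\<Sum>(a, b)\<leftarrow>xs. h a b)) \<le> norm (h a b) + norm (\<Sum>(a, b)\<leftarrow>xs. h a b)"
      by (rule norm_triangle_ineq)
    with Cons K(2)[of a b] show ?case by (auto simp: x distrib_left)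
  qed simp
  have le: "norm (linear_extension (\<lambda>(a, b). h a b) u) \<le> K * (\<Sum>(a, b)\<leftarrow>xs. norm a * norm b)"
    if "represents A B u xs" for xs
  proof -
    have "linear_extension (\<lambda>(a, b). h a b) (u - (\<Sum>(a, b)\<leftarrow>xs. formal_tensor a b)) = 0"
      using that by (intro linear_extension_bilinear_null[OF h]) (simp add: represents_def)
    then have "linear_extension (\<lambda>(a, b). h a b) u = (\<Sum>(a, b)\<leftarrow>xs. h a b)"
      by (simp add: linear_extension_diff linear_extension_sum_list)
    also have "norm \<dots> \<le> K * (\<Sum>(a, b)\<leftarrow>xs. norm a * norm b)"
      using that by (intro sum_le) (simp add: represents_def)
    finally show ?thesis .
  qed
  show ?thesis
  proof (cases "K = 0")
    case True
    with le ex_represents[OF A u] show ?thesis by auto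
  next
    case False
    have "norm (linear_extension (\<lambda>(a, b). h a b) u) / K \<le> proj_norm A B u"
      using le False K(1) by (intro le_proj_norm[OF A u]) (simp add: divide_le_eq mult.commute)
    then show ?thesis using False K(1) by (simp add: divide_le_eq mult.commute)
  qed
qed

definition bounded_clinear :: "('a::complex_normed_vector \<Rightarrow> 'b::complex_normed_vector) \<Rightarrow> bool"
  where "bounded_clinear f \<longleftrightarrow> bounded_linear f \<and> (\<forall>c x. f (c *\<^sub>C x) = c *\<^sub>C f x)"

definition formal_map ::
  "('a \<Rightarrow> 'c) \<Rightarrow> ('b \<Rightarrow> 'd) \<Rightarrow> ('a, 'b) formal_sum \<Rightarrow> ('c, 'd) formal_sum"
  where "formal_map f g = linear_extension (\<lambda>(a, b). formal_tensor (f a) (g b))"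

lemma formal_map_id: "formal_map id id u = u"
proof -
  have *: "(\<lambda>(a, b). formal_tensor (id a) (id b)) = (\<lambda>k. Poly_Mapping.single k 1)"
    by (auto simp: formal_tensor_def)
  show ?thesis
    unfolding formal_map_def * by (rule linear_extension_single_id)
qed

lemma formal_map_diff: "formal_map f g (u - v) = formal_map f g u - formal_map f g v"
  by (simp add: formal_map_def linear_extension_diff)

lemma formal_map_in:
  assumes "f ` A \<subseteq> C" "g ` B \<subseteq> D" "u \<in> formal_sums A B"
  shows "formal_map f g u \<in> formal_sums C D"
  unfolding formal_map_def linear_extension_def
proof (rule complex_vector.subspace_sum[OF csubspace_formal_sums])
  fix k assume "k \<in> Poly_Mapping.keys u"
  with assms(3) have "k \<in> A \<times> B" by (auto simp: formal_sums_def)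
  with assms(1,2) show "Poly_Mapping.lookup u k *\<^sub>C (case k of (a, b) \<Rightarrow> formal_tensor (f a) (g b)) \<in> formal_sums C D"
    by (auto intro!: formal_sums_scaleC formal_tensor_in)
qed

lemma represents_formal_map:
  assumes f: "bounded_clinear f" "f ` A \<subseteq> C" and g: "bounded_clinear g" "g ` B \<subseteq> D"
    and u: "represents A B u xs"
  shows "represents C D (formal_map f g u) (map (map_prod f g) xs)"
proof -
  have "linear_extension (\<lambda>(a, b). formal_tensor (f a) (g b)) (u - (\<Sum>(a, b)\<leftarrow>xs. formal_tensor a b))
      \<in> tensor_null C D"
  proof (rule linear_extension_null)
    show "u - (\<Sum>(a, b)\<leftarrow>xs. formal_tensor a b) \<in> tensor_null A B"
      using u by (simp add: represents_def)
    show "csubspace (tensor_null C D)"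
      by (simp add: tensor_null_def complex_vector.subspace_span)
    fix r assume "r \<in> bilinear_relators A B"
    from this[unfolded bilinear_relators_def]
    have "linear_extension (\<lambda>(a, b). formal_tensor (f a) (g b)) r \<in> bilinear_relators C D"
    proof (elim UnE CollectE exE conjE)
      fix a a' b assume *: "r = formal_tensor (a + a') b - formal_tensor a b - formal_tensor a' b" "a \<in> A" "a' \<in> A" "b \<in> B"
      show "linear_extension (\<lambda>(a, b). formal_tensor (f a) (g b)) r \<in> bilinear_relators C D"
        using * f g linear_simps(1)[of f] unfolding bilinear_relators_def bounded_clinear_def
        by (intro UnI1 CollectI exI[of _ "f a"] exI[of _ "f a'"] exI[of _ "g b"])
          (auto simp: linear_extension_diff)
    next
      fix a b b' assume *: "r = formal_tensor a (b + b') - formal_tensor a b - formal_tensor a b'" "a \<in> A" "b \<in> B" "b' \<in> B"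
      show "linear_extension (\<lambda>(a, b). formal_tensor (f a) (g b)) r \<in> bilinear_relators C D"
        using * f g linear_simps(1)[of g] unfolding bilinear_relators_def bounded_clinear_def
        by (intro UnI1[OF UnI1[OF UnI2]] CollectI exI[of _ "f a"] exI[of _ "g b"] exI[of _ "g b'"])
          (auto simp: linear_extension_diff)
    next
      fix c a b assume *: "r = formal_tensor (c *\<^sub>C a) b - c *\<^sub>C formal_tensor a b" "a \<in> A" "b \<in> B"
      show "linear_extension (\<lambda>(a, b). formal_tensor (f a) (g b)) r \<in> bilinear_relators C D"
        using * f g unfolding bilinear_relators_def bounded_clinear_def
        by (intro UnI1[OF UnI2] CollectI exI[of _ c] exI[of _ "f a"] exI[of _ "g b"])
          (auto simp: linear_extension_diff linear_extension_scaleC)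
    next
      fix c a b assume *: "r = formal_tensor a (c *\<^sub>C b) - c *\<^sub>C formal_tensor a b" "a \<in> A" "b \<in> B"
      show "linear_extension (\<lambda>(a, b). formal_tensor (f a) (g b)) r \<in> bilinear_relators C D"
        using * f g unfolding bilinear_relators_def bounded_clinear_def
        by (intro UnI2 CollectI exI[of _ c] exI[of _ "f a"] exI[of _ "g b"])
          (auto simp: linear_extension_diff linear_extension_scaleC)
    qed
    then show "linear_extension (\<lambda>(a, b). formal_tensor (f a) (g b)) r \<in> tensor_null C D"
      by (rule tensor_null_base)
  qed
  moreover have "linear_extension (\<lambda>(a, b). formal_tensor (f a) (g b)) (\<Sum>(a, b)\<leftarrow>xs. formal_tensor a b)
      = (\<Sum>(a, b)\<leftarrow>map (map_prod f g) xs. formal_tensor a b)"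
    unfolding linear_extension_sum_list by (simp add: comp_def case_prod_unfold)
  moreover have "set (map (map_prod f g) xs) \<subseteq> C \<times> D"
    using u f(2) g(2) unfolding represents_def by fastforce
  ultimately show ?thesis
    by (simp add: represents_def formal_map_def linear_extension_diff)
qed

lemma proj_norm_formal_map_le:
  assumes A: "csubspace A"
    and f: "bounded_clinear f" "f ` A \<subseteq> C" "0 \<le> K" "\<And>a. norm (f a) \<le> K * norm a"
    and g: "bounded_clinear g" "g ` B \<subseteq> D" "0 \<le> L" "\<And>b. norm (g b) \<le> L * norm b"
    and u: "u \<in> formal_sums A B"
  shows "proj_norm C D (formal_map f g u) \<le> K * L * proj_norm A B u"
proof -
  have le: "proj_norm C D (formal_map f g u) \<le> K * L * (\<Sum>(a, b)\<leftarrow>xs. norm a * norm b)"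
    if xs: "represents A B u xs" for xs
  proof -
    have "proj_norm C D (formal_map f g u) \<le> (\<Sum>(a, b)\<leftarrow>map (map_prod f g) xs. norm a * norm b)"
      by (rule proj_norm_le[OF represents_formal_map[OF f(1,2) g(1,2) xs]])
    also have "\<dots> \<le> K * L * (\<Sum>(a, b)\<leftarrow>xs. norm a * norm b)"
    proof (induction xs)
      case (Cons x xs)
      obtain a b where x: "x = (a, b)" by (cases x)
      have "norm (f a) * norm (g b) \<le> (K * norm a) * (L * norm b)"
        by (intro mult_mono f g) (use f(3) in auto)
      with Cons show ?case by (simp add: x algebra_simps)
    qed simp
    finally show ?thesis .
  qed
  show ?thesis
  proof (cases "K * L = 0")
    case True
    with le ex_represents[OF A u] show ?thesis by auto
  next
    case False
    then have "0 < K * L" using f(3) g(3) by auto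
    then have "proj_norm C D (formal_map f g u) / (K * L) \<le> proj_norm A B u"
      using le by (intro le_proj_norm[OF A u]) (simp add: divide_le_eq mult.commute)
    with \<open>0 < K * L\<close> show ?thesis by (simp add: divide_le_eq mult.commute)
  qed
qed


section \<open>The completed projective tensor product\<close>

text \<open>
  The completion of the algebraic tensor product in the projective norm: Cauchy sequences modulo
  null sequences.  The set-based \<open>ptensor_space A B\<close> serves the tensor product of subspaces, which
  cannot be obtained as a subset of the tensor product of the ambient spaces.
\<close>

definition tensor_Cauchy ::
  "'a::complex_normed_vector set \<Rightarrow> 'b::complex_normed_vector set \<Rightarrow> (nat \<Rightarrow> ('a, 'b) formal_sum) \<Rightarrow> bool"
  where "tensor_Cauchy A B s \<longleftrightarrow> (\<forall>n. s n \<in> formal_sums A B) \<and>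
    (\<forall>e>0. \<exists>N. \<forall>m\<ge>N. \<forall>n\<ge>N. proj_norm A B (s m - s n) < e)"

definition ptensor_rel ::
  "'a::complex_normed_vector set \<Rightarrow> 'b::complex_normed_vector set
    \<Rightarrow> (nat \<Rightarrow> ('a, 'b) formal_sum) \<Rightarrow> (nat \<Rightarrow> ('a, 'b) formal_sum) \<Rightarrow> bool"
  where "ptensor_rel A B s t \<longleftrightarrow> tensor_Cauchy A B s \<and> tensor_Cauchy A B t \<and>
    (\<lambda>n. proj_norm A B (s n - t n)) \<longlonglongrightarrow> 0"

definition ptensor_class ::
  "'a::complex_normed_vector set \<Rightarrow> 'b::complex_normed_vector set
    \<Rightarrow> (nat \<Rightarrow> ('a, 'b) formal_sum) \<Rightarrow> (nat \<Rightarrow> ('a, 'b) formal_sum) set"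
  where "ptensor_class A B s = {t. ptensor_rel A B s t}"

definition ptensor_space ::
  "'a::complex_normed_vector set \<Rightarrow> 'b::complex_normed_vector set \<Rightarrow> (nat \<Rightarrow> ('a, 'b) formal_sum) set set"
  where "ptensor_space A B = {ptensor_class A B s | s. tensor_Cauchy A B s}"

lemma tensor_Cauchy_in: "tensor_Cauchy A B s \<Longrightarrow> s n \<in> formal_sums A B"
  by (simp add: tensor_Cauchy_def)

lemma tensor_Cauchy_const: "csubspace A \<Longrightarrow> u \<in> formal_sums A B \<Longrightarrow> tensor_Cauchy A B (\<lambda>_. u)"
  by (simp add: tensor_Cauchy_def proj_norm_0)

lemma tensor_Cauchy_add:
  assumes A: "csubspace A" and s: "tensor_Cauchy A B s" and t: "tensor_Cauchy A B t"
  shows "tensor_Cauchy A B (\<lambda>n. s n + t n)"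
  unfolding tensor_Cauchy_def
proof (intro conjI allI impI)
  show "s n + t n \<in> formal_sums A B" for n
    by (intro formal_sums_add tensor_Cauchy_in s t)
  fix e :: real assume "0 < e"
  then obtain N1 N2
    where N1: "\<And>m n. m \<ge> N1 \<Longrightarrow> n \<ge> N1 \<Longrightarrow> proj_norm A B (s m - s n) < e / 2"
      and N2: "\<And>m n. m \<ge> N2 \<Longrightarrow> n \<ge> N2 \<Longrightarrow> proj_norm A B (t m - t n) < e / 2"
    using s t unfolding tensor_Cauchy_def by (meson half_gt_zero)
  have "proj_norm A B (s m + t m - (s n + t n)) < e" if "m \<ge> max N1 N2" "n \<ge> max N1 N2" for m n
  proof -
    have "proj_norm A B ((s m - s n) + (t m - t n)) \<le> proj_norm A B (s m - s n) + proj_norm A B (t m - t n)"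
      by (intro proj_norm_triangle[OF A] formal_sums_diff tensor_Cauchy_in s t)
    with N1[of m n] N2[of m n] that show ?thesis by (simp add: algebra_simps)
  qed
  then show "\<exists>N. \<forall>m\<ge>N. \<forall>n\<ge>N. proj_norm A B (s m + t m - (s n + t n)) < e" by blast
qed

lemma tensor_Cauchy_scaleC:
  assumes A: "csubspace A" and s: "tensor_Cauchy A B s"
  shows "tensor_Cauchy A B (\<lambda>n. c *\<^sub>C s n)"
  unfolding tensor_Cauchy_def
proof (intro conjI allI impI)
  show "c *\<^sub>C s n \<in> formal_sums A B" for n
    by (intro formal_sums_scaleC tensor_Cauchy_in s)
  fix e :: real assume e: "0 < e"
  have pos: "0 < e / (cmod c + 1)" using e by (simp add: add_nonneg_pos)
  then obtain N where N: "\<And>m n. m \<ge> N \<Longrightarrow> n \<ge> N \<Longrightarrow> proj_norm A B (s m - s n) < e / (cmod c + 1)"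
    using s unfolding tensor_Cauchy_def by meson
  have "proj_norm A B (c *\<^sub>C s m - c *\<^sub>C s n) < e" if "m \<ge> N" "n \<ge> N" for m n
  proof -
    have "proj_norm A B (c *\<^sub>C s m - c *\<^sub>C s n) = cmod c * proj_norm A B (s m - s n)"
      using proj_norm_scaleC[OF A formal_sums_diff[OF tensor_Cauchy_in[OF s] tensor_Cauchy_in[OF s]]]
      by (simp add: complex_vector.scale_right_diff_distrib)
    also have "\<dots> \<le> cmod c * (e / (cmod c + 1))"
      using N[OF that] by (intro mult_left_mono) auto
    also have "\<dots> < e"
    proof -
      have "cmod c * e < e * (cmod c + 1)" using e by (simp add: algebra_simps)
      then show ?thesis by (simp add: divide_less_eq add_nonneg_pos)
    qed
    finally show ?thesis .
  qed
  then show "\<exists>N. \<forall>m\<ge>N. \<forall>n\<ge>N. proj_norm A B (c *\<^sub>C s m - c *\<^sub>C s n) < e" by blast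
qed

lemma tensor_Cauchy_minus: "csubspace A \<Longrightarrow> tensor_Cauchy A B s \<Longrightarrow> tensor_Cauchy A B (\<lambda>n. - s n)"
  using tensor_Cauchy_scaleC[of A B s "- 1"] by simp

lemma tensor_Cauchy_diff:
  "csubspace A \<Longrightarrow> tensor_Cauchy A B s \<Longrightarrow> tensor_Cauchy A B t \<Longrightarrow> tensor_Cauchy A B (\<lambda>n. s n - t n)"
  using tensor_Cauchy_add[of A B s "\<lambda>n. - t n"] tensor_Cauchy_minus[of A B t] by simp

lemma proj_norm_diff_le:
  assumes A: "csubspace A" and u: "u \<in> formal_sums A B" and v: "v \<in> formal_sums A B"
  shows "\<bar>proj_norm A B u - proj_norm A B v\<bar> \<le> proj_norm A B (u - v)"
  using proj_norm_triangle[OF A formal_sums_diff[OF u v] v] proj_norm_triangle[OF A formal_sums_diff[OF v u] u]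
    proj_norm_minus_commute[OF A u v] by simp

lemma convergent_proj_norm:
  assumes A: "csubspace A" and s: "tensor_Cauchy A B s"
  shows "convergent (\<lambda>n. proj_norm A B (s n))"
proof -
  have "Cauchy (\<lambda>n. proj_norm A B (s n))"
  proof (rule CauchyI)
    fix e :: real assume "0 < e"
    then obtain N where "\<And>m n. m \<ge> N \<Longrightarrow> n \<ge> N \<Longrightarrow> proj_norm A B (s m - s n) < e"
      using s unfolding tensor_Cauchy_def by meson
    then have "norm (proj_norm A B (s m) - proj_norm A B (s n)) < e" if "m \<ge> N" "n \<ge> N" for m n
      using proj_norm_diff_le[OF A tensor_Cauchy_in[OF s, of m] tensor_Cauchy_in[OF s, of n]] that
      by fastforce
    then show "\<exists>M. \<forall>m\<ge>M. \<forall>n\<ge>M. norm (proj_norm A B (s m) - proj_norm A B (s n)) < e"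
      by blast
  qed
  then show ?thesis by (simp add: Cauchy_convergent_iff)
qed

lemma ptensor_rel_refl: "csubspace A \<Longrightarrow> tensor_Cauchy A B s \<Longrightarrow> ptensor_rel A B s s"
  by (simp add: ptensor_rel_def proj_norm_0)

lemma ptensor_rel_sym: "csubspace A \<Longrightarrow> ptensor_rel A B s t \<Longrightarrow> ptensor_rel A B t s"
  using proj_norm_minus_commute[of A _ B] by (simp add: ptensor_rel_def tensor_Cauchy_in)

lemma proj_norm_tendsto_0_I:
  assumes A: "csubspace A" and "\<And>n. u n \<in> formal_sums A B" "\<And>n. proj_norm A B (u n) \<le> f n" "f \<longlonglongrightarrow> 0"
  shows "(\<lambda>n. proj_norm A B (u n)) \<longlonglongrightarrow> 0"
  by (rule tendsto_sandwich[OF _ _ tendsto_const assms(4)])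
    (use assms(2,3) proj_norm_nonneg[OF A] in \<open>auto intro!: always_eventually\<close>)

lemma ptensor_rel_add:
  assumes A: "csubspace A" and s: "ptensor_rel A B s s'" and t: "ptensor_rel A B t t'"
  shows "ptensor_rel A B (\<lambda>n. s n + t n) (\<lambda>n. s' n + t' n)"
proof -
  have C: "tensor_Cauchy A B s" "tensor_Cauchy A B s'" "tensor_Cauchy A B t" "tensor_Cauchy A B t'"
    using s t by (auto simp: ptensor_rel_def)
  have "(\<lambda>n. proj_norm A B (s n + t n - (s' n + t' n))) \<longlonglongrightarrow> 0"
  proof (rule proj_norm_tendsto_0_I[OF A])
    show "s n + t n - (s' n + t' n) \<in> formal_sums A B" for n
      by (intro formal_sums_diff formal_sums_add tensor_Cauchy_in C)
    have "proj_norm A B ((s n - s' n) + (t n - t' n)) \<le> proj_norm A B (s n - s' n) + proj_norm A B (t n - t' n)" for n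
      by (intro proj_norm_triangle[OF A] formal_sums_diff tensor_Cauchy_in C)
    then show "proj_norm A B (s n + t n - (s' n + t' n)) \<le> proj_norm A B (s n - s' n) + proj_norm A B (t n - t' n)" for n
      by (simp add: algebra_simps)
    show "(\<lambda>n. proj_norm A B (s n - s' n) + proj_norm A B (t n - t' n)) \<longlonglongrightarrow> 0"
      using tendsto_add[of "\<lambda>n. proj_norm A B (s n - s' n)" 0 sequentially "\<lambda>n. proj_norm A B (t n - t' n)" 0] s t
      by (simp add: ptensor_rel_def)
  qed
  with C show ?thesis by (simp add: ptensor_rel_def tensor_Cauchy_add[OF A])
qed

lemma ptensor_rel_scaleC:
  assumes A: "csubspace A" and s: "ptensor_rel A B s s'"
  shows "ptensor_rel A B (\<lambda>n. c *\<^sub>C s n) (\<lambda>n. c *\<^sub>C s' n)"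
proof -
  have C: "tensor_Cauchy A B s" "tensor_Cauchy A B s'"
    using s by (auto simp: ptensor_rel_def)
  have "proj_norm A B (c *\<^sub>C s n - c *\<^sub>C s' n) = cmod c * proj_norm A B (s n - s' n)" for n
    using proj_norm_scaleC[OF A formal_sums_diff[OF tensor_Cauchy_in[OF C(1)] tensor_Cauchy_in[OF C(2)]]]
    by (simp add: complex_vector.scale_right_diff_distrib)
  moreover have "(\<lambda>n. cmod c * proj_norm A B (s n - s' n)) \<longlonglongrightarrow> 0"
    using s by (intro tendsto_mult_right_zero) (simp add: ptensor_rel_def)
  ultimately show ?thesis
    using C by (simp add: ptensor_rel_def tensor_Cauchy_scaleC[OF A])
qed

lemma ptensor_rel_minus: "csubspace A \<Longrightarrow> ptensor_rel A B s s' \<Longrightarrow> ptensor_rel A B (\<lambda>n. - s n) (\<lambda>n. - s' n)"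
  using ptensor_rel_scaleC[of A B s s' "- 1"] by simp

lemma ptensor_rel_diff:
  "csubspace A \<Longrightarrow> ptensor_rel A B s s' \<Longrightarrow> ptensor_rel A B t t'
    \<Longrightarrow> ptensor_rel A B (\<lambda>n. s n - t n) (\<lambda>n. s' n - t' n)"
  using ptensor_rel_add[of A B s s' "\<lambda>n. - t n" "\<lambda>n. - t' n"] ptensor_rel_minus[of A B t t'] by simp

lemma ptensor_rel_trans:
  assumes A: "csubspace A" and st: "ptensor_rel A B s t" and tr: "ptensor_rel A B t r"
  shows "ptensor_rel A B s r"
proof -
  have C: "tensor_Cauchy A B s" "tensor_Cauchy A B t" "tensor_Cauchy A B r"
    using st tr by (auto simp: ptensor_rel_def)
  have "(\<lambda>n. proj_norm A B (s n - r n)) \<longlonglongrightarrow> 0"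
    using ptensor_rel_add[OF A st tr] by (auto simp: ptensor_rel_def algebra_simps)
  with C show ?thesis by (simp add: ptensor_rel_def)
qed

lemma ptensor_class_eq_iff:
  assumes A: "csubspace A" and s: "tensor_Cauchy A B s" and t: "tensor_Cauchy A B t"
  shows "ptensor_class A B s = ptensor_class A B t \<longleftrightarrow> ptensor_rel A B s t"
proof
  assume "ptensor_class A B s = ptensor_class A B t"
  then show "ptensor_rel A B s t"
    using ptensor_rel_refl[OF A t] by (auto simp: ptensor_class_def)
next
  assume "ptensor_rel A B s t"
  then show "ptensor_class A B s = ptensor_class A B t"
    using ptensor_rel_sym[OF A] ptensor_rel_trans[OF A] unfolding ptensor_class_def by blast
qed

text \<open>The map \<open>A \<otimes> B \<rightarrow> C \<otimes> D\<close> induced by bounded operators \<open>f: A \<rightarrow> C\<close> and \<open>g: B \<rightarrow> D\<close>.\<close>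

definition ptensor_map ::
  "'c::complex_normed_vector set \<Rightarrow> 'd::complex_normed_vector set \<Rightarrow> ('a \<Rightarrow> 'c) \<Rightarrow> ('b \<Rightarrow> 'd)
    \<Rightarrow> (nat \<Rightarrow> ('a, 'b) formal_sum) set \<Rightarrow> (nat \<Rightarrow> ('c, 'd) formal_sum) set"
  where "ptensor_map C D f g M = (\<Union>s\<in>M. ptensor_class C D (\<lambda>n. formal_map f g (s n)))"

lemma ptensor_rel_formal_map:
  assumes A: "csubspace A" and C: "csubspace C"
    and f: "bounded_clinear f" "f ` A \<subseteq> C" and g: "bounded_clinear g" "g ` B \<subseteq> D"
    and s: "tensor_Cauchy A B s"
  shows "tensor_Cauchy C D (\<lambda>n. formal_map f g (s n))"
    and "ptensor_rel A B s t \<Longrightarrow> ptensor_rel C D (\<lambda>n. formal_map f g (s n)) (\<lambda>n. formal_map f g (t n))"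
proof -
  obtain K where K: "0 < K" "\<And>a. norm (f a) \<le> K * norm a"
    using f(1) bounded_linear.pos_bounded[of f] by (auto simp: bounded_clinear_def mult.commute)
  obtain L where L: "0 < L" "\<And>b. norm (g b) \<le> L * norm b"
    using g(1) bounded_linear.pos_bounded[of g] by (auto simp: bounded_clinear_def mult.commute)
  have le: "proj_norm C D (formal_map f g u - formal_map f g v) \<le> K * L * proj_norm A B (u - v)"
    if "u \<in> formal_sums A B" "v \<in> formal_sums A B" for u v
    using proj_norm_formal_map_le[OF A f _ K(2) g _ L(2) formal_sums_diff[OF that]] K(1) L(1)
    by (simp add: formal_map_diff)
  have Cau: "tensor_Cauchy C D (\<lambda>n. formal_map f g (s n))" if s: "tensor_Cauchy A B s" for s
    unfolding tensor_Cauchy_def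
  proof (intro conjI allI impI)
    show "formal_map f g (s n) \<in> formal_sums C D" for n
      by (rule formal_map_in[OF f(2) g(2) tensor_Cauchy_in[OF s]])
    fix e :: real assume "0 < e"
    then have "0 < e / (K * L)" using K(1) L(1) by simp
    then obtain N where N: "\<And>m n. m \<ge> N \<Longrightarrow> n \<ge> N \<Longrightarrow> proj_norm A B (s m - s n) < e / (K * L)"
      using s unfolding tensor_Cauchy_def by meson
    have "proj_norm C D (formal_map f g (s m) - formal_map f g (s n)) < e" if "m \<ge> N" "n \<ge> N" for m n
      using le[OF tensor_Cauchy_in[OF s] tensor_Cauchy_in[OF s], of m n] N[OF that] K(1) L(1)
      by (simp add: less_divide_eq mult.commute)
    then show "\<exists>N. \<forall>m\<ge>N. \<forall>n\<ge>N. proj_norm C D (formal_map f g (s m) - formal_map f g (s n)) < e"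
      by blast
  qed
  show "tensor_Cauchy C D (\<lambda>n. formal_map f g (s n))"
    by (rule Cau[OF s])
  assume st: "ptensor_rel A B s t"
  then have t: "tensor_Cauchy A B t" by (simp add: ptensor_rel_def)
  have "(\<lambda>n. proj_norm C D (formal_map f g (s n) - formal_map f g (t n))) \<longlonglongrightarrow> 0"
  proof (rule proj_norm_tendsto_0_I[OF C])
    show "formal_map f g (s n) - formal_map f g (t n) \<in> formal_sums C D" for n
      by (intro formal_sums_diff tensor_Cauchy_in[of C D "\<lambda>n. formal_map f g (s n)"]
          tensor_Cauchy_in[of C D "\<lambda>n. formal_map f g (t n)"] Cau s t)
    show "proj_norm C D (formal_map f g (s n) - formal_map f g (t n)) \<le> K * L * proj_norm A B (s n - t n)" for n
      by (intro le tensor_Cauchy_in s t)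
    show "(\<lambda>n. K * L * proj_norm A B (s n - t n)) \<longlonglongrightarrow> 0"
      using st by (intro tendsto_mult_right_zero) (simp add: ptensor_rel_def)
  qed
  then show "ptensor_rel C D (\<lambda>n. formal_map f g (s n)) (\<lambda>n. formal_map f g (t n))"
    using Cau[OF s] Cau[OF t] by (simp add: ptensor_rel_def)
qed

lemma ptensor_map_class:
  assumes A: "csubspace A" and C: "csubspace C"
    and f: "bounded_clinear f" "f ` A \<subseteq> C" and g: "bounded_clinear g" "g ` B \<subseteq> D"
    and s: "tensor_Cauchy A B s"
  shows "ptensor_map C D f g (ptensor_class A B s) = ptensor_class C D (\<lambda>n. formal_map f g (s n))"
proof -
  have "ptensor_class C D (\<lambda>n. formal_map f g (t n)) = ptensor_class C D (\<lambda>n. formal_map f g (s n))"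
    if "t \<in> ptensor_class A B s" for t
  proof -
    from that have st: "ptensor_rel A B s t" by (simp add: ptensor_class_def)
    then have t: "tensor_Cauchy A B t" by (simp add: ptensor_rel_def)
    note ts = ptensor_rel_sym[OF A st]
    note * = ptensor_rel_formal_map[OF assms(1-6)]
    show ?thesis
      by (rule ptensor_class_eq_iff[OF C *(1)[OF t] *(1)[OF s], THEN iffD2, OF *(2)[OF t ts]])
  qed
  moreover have "s \<in> ptensor_class A B s"
    using ptensor_rel_refl[OF A s] by (simp add: ptensor_class_def)
  ultimately show ?thesis unfolding ptensor_map_def by blast
qed

text \<open>
  For two whole spaces the completed tensor product is made into a type; its elements are the
  members of \<open>ptensor_space UNIV UNIV\<close>.
\<close>

quotient_type (overloaded) ('a, 'b) ptensor =
  "nat \<Rightarrow> ('a::complex_normed_vector, 'b::complex_normed_vector) formal_sum" / partial: "ptensor_rel UNIV UNIV"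
proof (rule part_equivpI)
  show "\<exists>s. ptensor_rel UNIV UNIV s s"
    by (rule exI[of _ "\<lambda>_. 0"]) (intro ptensor_rel_refl tensor_Cauchy_const complex_vector.subspace_UNIV formal_sums_0)
  show "symp (ptensor_rel UNIV UNIV)"
    by (intro sympI) (rule ptensor_rel_sym[OF complex_vector.subspace_UNIV])
  show "transp (ptensor_rel UNIV UNIV)"
    by (intro transpI) (rule ptensor_rel_trans[OF complex_vector.subspace_UNIV])
qed

lemma ptensor_rel_self_iff: "ptensor_rel UNIV UNIV s s \<longleftrightarrow> tensor_Cauchy UNIV UNIV s"
  using ptensor_rel_refl[OF complex_vector.subspace_UNIV] by (auto simp: ptensor_rel_def)

lemma abs_ptensor_eq_iff:
  "tensor_Cauchy UNIV UNIV s \<Longrightarrow> tensor_Cauchy UNIV UNIV t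
    \<Longrightarrow> abs_ptensor s = abs_ptensor t \<longleftrightarrow> ptensor_rel UNIV UNIV s t"
  using Quotient_rel[OF Quotient_ptensor, of s t] by (simp add: ptensor_rel_self_iff)

lemma ptensor_cases:
  obtains s where "x = abs_ptensor s" "tensor_Cauchy UNIV UNIV s"
proof -
  have "ptensor_rel UNIV UNIV (rep_ptensor x) (rep_ptensor x)"
    by (rule Quotient_rep_reflp[OF Quotient_ptensor])
  then show ?thesis
    using that[of "rep_ptensor x"] Quotient_abs_rep[OF Quotient_ptensor, of x]
    by (simp add: ptensor_rel_self_iff)
qed

lemma ptensor_norm_respects:
  assumes "ptensor_rel UNIV UNIV s t"
  shows "lim (\<lambda>n. proj_norm UNIV UNIV (s n)) = lim (\<lambda>n. proj_norm UNIV UNIV (t n))"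
proof -
  note U = complex_vector.subspace_UNIV
  have C: "tensor_Cauchy UNIV UNIV s" "tensor_Cauchy UNIV UNIV t"
    and 0: "(\<lambda>n. proj_norm UNIV UNIV (s n - t n)) \<longlonglongrightarrow> 0"
    using assms by (auto simp: ptensor_rel_def)
  have "(\<lambda>n. proj_norm UNIV UNIV (s n) - proj_norm UNIV UNIV (t n)) \<longlonglongrightarrow> 0"
    by (rule Lim_null_comparison[OF _ 0]) (auto intro!: always_eventually proj_norm_diff_le[OF U])
  moreover
  have "(\<lambda>n. proj_norm UNIV UNIV (s n)) \<longlonglongrightarrow> lim (\<lambda>n. proj_norm UNIV UNIV (s n))"
    and "(\<lambda>n. proj_norm UNIV UNIV (t n)) \<longlonglongrightarrow> lim (\<lambda>n. proj_norm UNIV UNIV (t n))"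
    using convergent_proj_norm[OF U C(1)] convergent_proj_norm[OF U C(2)] by (auto simp: convergent_LIMSEQ_iff)
  from tendsto_diff[OF this] have "(\<lambda>n. proj_norm UNIV UNIV (s n) - proj_norm UNIV UNIV (t n)) \<longlonglongrightarrow>
      lim (\<lambda>n. proj_norm UNIV UNIV (s n)) - lim (\<lambda>n. proj_norm UNIV UNIV (t n))" .
  ultimately have "0 = lim (\<lambda>n. proj_norm UNIV UNIV (s n)) - lim (\<lambda>n. proj_norm UNIV UNIV (t n))"
    by (rule LIMSEQ_unique)
  then show ?thesis by simp
qed

instantiation ptensor :: (complex_normed_vector, complex_normed_vector) complex_normed_vector
begin

lift_definition zero_ptensor :: "('a, 'b) ptensor" is "\<lambda>_. 0"
  by (simp add: ptensor_rel_self_iff tensor_Cauchy_const)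
lift_definition plus_ptensor :: "('a, 'b) ptensor \<Rightarrow> ('a, 'b) ptensor \<Rightarrow> ('a, 'b) ptensor"
  is "\<lambda>s t n. s n + t n" by (rule ptensor_rel_add[OF complex_vector.subspace_UNIV])
lift_definition minus_ptensor :: "('a, 'b) ptensor \<Rightarrow> ('a, 'b) ptensor \<Rightarrow> ('a, 'b) ptensor"
  is "\<lambda>s t n. s n - t n" by (rule ptensor_rel_diff[OF complex_vector.subspace_UNIV])
lift_definition uminus_ptensor :: "('a, 'b) ptensor \<Rightarrow> ('a, 'b) ptensor"
  is "\<lambda>s n. - s n" by (rule ptensor_rel_minus[OF complex_vector.subspace_UNIV])
lift_definition scaleC_ptensor :: "complex \<Rightarrow> ('a, 'b) ptensor \<Rightarrow> ('a, 'b) ptensor"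
  is "\<lambda>c s n. c *\<^sub>C s n" by (rule ptensor_rel_scaleC[OF complex_vector.subspace_UNIV])
definition scaleR_ptensor :: "real \<Rightarrow> ('a, 'b) ptensor \<Rightarrow> ('a, 'b) ptensor"
  where "scaleR_ptensor r x = scaleC (complex_of_real r) x"
lift_definition norm_ptensor :: "('a, 'b) ptensor \<Rightarrow> real"
  is "\<lambda>s. lim (\<lambda>n. proj_norm UNIV UNIV (s n))" by (rule ptensor_norm_respects)
definition dist_ptensor :: "('a, 'b) ptensor \<Rightarrow> ('a, 'b) ptensor \<Rightarrow> real"
  where "dist_ptensor x y = norm (x - y)"
definition sgn_ptensor :: "('a, 'b) ptensor \<Rightarrow> ('a, 'b) ptensor"
  where "sgn_ptensor x = scaleR (inverse (norm x)) x"
definition uniformity_ptensor :: "(('a, 'b) ptensor \<times> ('a, 'b) ptensor) filter"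
  where [code del]: "uniformity_ptensor = (INF e\<in>{0<..}. principal {(x, y). dist x y < e})"
definition open_ptensor :: "('a, 'b) ptensor set \<Rightarrow> bool"
  where [code del]: "open_ptensor U = (\<forall>x\<in>U. \<forall>\<^sub>F (x', y) in uniformity. x' = x \<longrightarrow> y \<in> U)"

lemma abs_ptensor_ops:
  "tensor_Cauchy UNIV UNIV s \<Longrightarrow> tensor_Cauchy UNIV UNIV t
    \<Longrightarrow> abs_ptensor s + abs_ptensor t = abs_ptensor (\<lambda>n. s n + t n)"
  "tensor_Cauchy UNIV UNIV s \<Longrightarrow> tensor_Cauchy UNIV UNIV t
    \<Longrightarrow> abs_ptensor s - abs_ptensor t = abs_ptensor (\<lambda>n. s n - t n)"
  "tensor_Cauchy UNIV UNIV s \<Longrightarrow> - abs_ptensor s = abs_ptensor (\<lambda>n. - s n)"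
  "tensor_Cauchy UNIV UNIV s \<Longrightarrow> c *\<^sub>C abs_ptensor s = abs_ptensor (\<lambda>n. c *\<^sub>C s n)"
  unfolding ptensor_rel_self_iff[symmetric]
  by (simp_all add: plus_ptensor.abs_eq minus_ptensor.abs_eq uminus_ptensor.abs_eq scaleC_ptensor.abs_eq)

lemma tendsto_norm_abs_ptensor:
  assumes s: "tensor_Cauchy UNIV UNIV s"
  shows "(\<lambda>n. proj_norm UNIV UNIV (s n)) \<longlonglongrightarrow> norm (abs_ptensor s)"
  using convergent_proj_norm[OF complex_vector.subspace_UNIV s] s
  by (simp add: norm_ptensor.abs_eq ptensor_rel_self_iff convergent_LIMSEQ_iff)

lemma norm_abs_ptensor_eqI:
  "tensor_Cauchy UNIV UNIV s \<Longrightarrow> (\<lambda>n. proj_norm UNIV UNIV (s n)) \<longlonglongrightarrow> l \<Longrightarrow> norm (abs_ptensor s) = l"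
  using tendsto_norm_abs_ptensor LIMSEQ_unique by blast

instance
proof
  note U = complex_vector.subspace_UNIV
  note C = tensor_Cauchy_add[OF U] tensor_Cauchy_scaleC[OF U] tensor_Cauchy_minus[OF U]
    tensor_Cauchy_diff[OF U] tensor_Cauchy_const[OF U formal_sums_UNIV]
  fix x y z :: "('a, 'b) ptensor" and c d :: complex and p q :: real
  obtain s t u where x: "x = abs_ptensor s" and s: "tensor_Cauchy UNIV UNIV s"
    and y: "y = abs_ptensor t" and t: "tensor_Cauchy UNIV UNIV t"
    and z: "z = abs_ptensor u" and u: "tensor_Cauchy UNIV UNIV u"
    by (metis ptensor_cases)
  note ops = abs_ptensor_ops zero_ptensor_def C s t u
  show add: "x + y + z = x + (y + z)" "x + y = y + x" "0 + x = x" "- x + x = 0" "x - y = x + - y"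
    unfolding x y z by (simp_all add: ops algebra_simps)
  have sc: "c *\<^sub>C (x + y) = c *\<^sub>C x + c *\<^sub>C y" "(c + d) *\<^sub>C x = c *\<^sub>C x + d *\<^sub>C x"
    "c *\<^sub>C d *\<^sub>C x = (c * d) *\<^sub>C x" "1 *\<^sub>C x = x" for c d
    unfolding x y by (simp_all add: ops scaleC_add_right scaleC_add_left scaleC_scaleC scaleC_one)
  show "c *\<^sub>C (x + y) = c *\<^sub>C x + c *\<^sub>C y" "(c + d) *\<^sub>C x = c *\<^sub>C x + d *\<^sub>C x"
    "c *\<^sub>C d *\<^sub>C x = (c * d) *\<^sub>C x" "1 *\<^sub>C x = x" "p *\<^sub>R x = complex_of_real p *\<^sub>C x"
    "p *\<^sub>R (x + y) = p *\<^sub>R x + p *\<^sub>R y" "(p + q) *\<^sub>R x = p *\<^sub>R x + q *\<^sub>R x"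
    "p *\<^sub>R q *\<^sub>R x = (p * q) *\<^sub>R x" "1 *\<^sub>R x = x"
    by (simp_all add: sc scaleR_ptensor_def)
  show nsc: "norm (c *\<^sub>C x) = cmod c * norm x" for c
  proof -
    have "(\<lambda>n. cmod c * proj_norm UNIV UNIV (s n)) \<longlonglongrightarrow> cmod c * norm x"
      unfolding x by (intro tendsto_mult_left tendsto_norm_abs_ptensor s)
    then show ?thesis
      unfolding x by (simp add: ops norm_abs_ptensor_eqI proj_norm_scaleC[OF U])
  qed
  show "norm (p *\<^sub>R x) = \<bar>p\<bar> * norm x"
    by (simp add: nsc scaleR_ptensor_def)
  show "norm (x + y) \<le> norm x + norm y"
  proof (rule LIMSEQ_le)
    show "(\<lambda>n. proj_norm UNIV UNIV (s n + t n)) \<longlonglongrightarrow> norm (x + y)"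
      unfolding x y using tendsto_norm_abs_ptensor[OF C(1)[OF s t]] by (simp add: ops)
    show "(\<lambda>n. proj_norm UNIV UNIV (s n) + proj_norm UNIV UNIV (t n)) \<longlonglongrightarrow> norm x + norm y"
      unfolding x y by (intro tendsto_add tendsto_norm_abs_ptensor s t)
  qed (simp add: proj_norm_triangle[OF U])
  show "norm x = 0 \<longleftrightarrow> x = 0"
  proof
    assume "norm x = 0"
    then have "ptensor_rel UNIV UNIV s (\<lambda>_. 0)"
      using tendsto_norm_abs_ptensor[OF s] by (simp add: ptensor_rel_def s C x)
    then show "x = 0"
      by (simp add: x zero_ptensor_def abs_ptensor_eq_iff s C)
  next
    assume "x = 0"
    then show "norm x = 0"
      by (simp add: zero_ptensor_def norm_abs_ptensor_eqI C proj_norm_0[OF U])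
  qed
qed (simp_all add: dist_ptensor_def sgn_ptensor_def uniformity_ptensor_def open_ptensor_def)

end

definition ptensor_of_formal :: "('a::complex_normed_vector, 'b::complex_normed_vector) formal_sum \<Rightarrow> ('a, 'b) ptensor"
  where "ptensor_of_formal u = abs_ptensor (\<lambda>_. u)"

definition elementary_tensor :: "'a::complex_normed_vector \<Rightarrow> 'b::complex_normed_vector \<Rightarrow> ('a, 'b) ptensor"
  (infixr \<open>\<otimes>\<^sub>\<gamma>\<close> 70)
  where "a \<otimes>\<^sub>\<gamma> b = ptensor_of_formal (formal_tensor a b)"

lemma tensor_Cauchy_UNIV_const: "tensor_Cauchy UNIV UNIV (\<lambda>_. u)"
  by (simp add: tensor_Cauchy_const)

lemma ptensor_of_formal_add: "ptensor_of_formal (u + v) = ptensor_of_formal u + ptensor_of_formal v"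
  by (simp add: ptensor_of_formal_def abs_ptensor_ops tensor_Cauchy_UNIV_const)

lemma ptensor_of_formal_diff: "ptensor_of_formal (u - v) = ptensor_of_formal u - ptensor_of_formal v"
  by (simp add: ptensor_of_formal_def abs_ptensor_ops tensor_Cauchy_UNIV_const)

lemma ptensor_of_formal_scaleC: "ptensor_of_formal (c *\<^sub>C u) = c *\<^sub>C ptensor_of_formal u"
  by (simp add: ptensor_of_formal_def abs_ptensor_ops tensor_Cauchy_UNIV_const)

lemma norm_ptensor_of_formal: "norm (ptensor_of_formal u) = proj_norm UNIV UNIV u"
  unfolding ptensor_of_formal_def by (rule norm_abs_ptensor_eqI) (simp_all add: tensor_Cauchy_UNIV_const)

lemma ptensor_of_formal_null: "u \<in> tensor_null UNIV UNIV \<Longrightarrow> ptensor_of_formal u = 0"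
  using norm_ptensor_of_formal[of u] proj_norm_null[of UNIV u UNIV] by simp

lemma ptensor_of_formal_tendsto:
  assumes s: "tensor_Cauchy UNIV UNIV s"
  shows "(\<lambda>n. ptensor_of_formal (s n)) \<longlonglongrightarrow> abs_ptensor s"
proof (rule LIMSEQ_I)
  fix e :: real assume "0 < e"
  then obtain N where N: "\<And>m n. m \<ge> N \<Longrightarrow> n \<ge> N \<Longrightarrow> proj_norm UNIV UNIV (s m - s n) < e / 2"
    using s unfolding tensor_Cauchy_def by (meson half_gt_zero)
  have "norm (ptensor_of_formal (s n) - abs_ptensor s) < e" if "n \<ge> N" for n
  proof -
    have C: "tensor_Cauchy UNIV UNIV (\<lambda>m. s n - s m)"
      by (intro tensor_Cauchy_diff tensor_Cauchy_UNIV_const s) simp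
    have "norm (abs_ptensor (\<lambda>m. s n - s m)) \<le> e / 2"
      using N[OF that] by (intro LIMSEQ_le_const2[OF tendsto_norm_abs_ptensor[OF C]]) (auto intro: less_imp_le)
    then show ?thesis
      using \<open>0 < e\<close> by (simp add: ptensor_of_formal_def abs_ptensor_ops tensor_Cauchy_UNIV_const s)
  qed
  then show "\<exists>N. \<forall>n\<ge>N. norm (ptensor_of_formal (s n) - abs_ptensor s) < e" by blast
qed

instance ptensor :: (complex_normed_vector, complex_normed_vector) complex_banach
proof
  fix X :: "nat \<Rightarrow> ('a, 'b) ptensor" assume X: "Cauchy X"
  have "\<exists>u. norm (X n - ptensor_of_formal u) < 1 / (real n + 1)" for n
  proof -
    obtain s where s: "X n = abs_ptensor s" "tensor_Cauchy UNIV UNIV s" by (rule ptensor_cases)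
    have "0 < 1 / (real n + 1)" by simp
    with LIMSEQ_D[OF ptensor_of_formal_tendsto[OF s(2)]] show ?thesis
      by (metis norm_minus_commute order_refl s(1))
  qed
  then obtain u where u: "\<And>n. norm (X n - ptensor_of_formal (u n)) < 1 / (real n + 1)" by metis
  have lim0: "(\<lambda>n. X n - ptensor_of_formal (u n)) \<longlonglongrightarrow> 0"
  proof (rule Lim_null_comparison)
    show "\<forall>\<^sub>F n in sequentially. norm (X n - ptensor_of_formal (u n)) \<le> 1 / (real n + 1)"
      using u by (auto intro!: always_eventually less_imp_le)
    show "(\<lambda>n. 1 / (real n + 1)) \<longlonglongrightarrow> 0"
      using LIMSEQ_inverse_real_of_nat by (simp add: inverse_eq_divide add.commute)
  qed
  have "Cauchy (\<lambda>n. ptensor_of_formal (u n))"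
  proof -
    let ?d = "\<lambda>n. X n - ptensor_of_formal (u n)"
    show ?thesis
    proof (rule CauchyI)
      fix e :: real assume "0 < e"
      then obtain M N where M: "\<And>m n. m \<ge> M \<Longrightarrow> n \<ge> M \<Longrightarrow> norm (X m - X n) < e / 2"
        and N: "\<And>m n. m \<ge> N \<Longrightarrow> n \<ge> N \<Longrightarrow> norm (?d m - ?d n) < e / 2"
        using CauchyD[OF X] CauchyD[OF LIMSEQ_imp_Cauchy[OF lim0]] by (meson half_gt_zero)
      have "norm (ptensor_of_formal (u m) - ptensor_of_formal (u n)) < e"
        if "m \<ge> max M N" "n \<ge> max M N" for m n
        using norm_triangle_ineq4[of "X m - X n" "?d m - ?d n"] M[of m n] N[of m n] that
        by (simp add: algebra_simps)
      then show "\<exists>M. \<forall>m\<ge>M. \<forall>n\<ge>M. norm (ptensor_of_formal (u m) - ptensor_of_formal (u n)) < e"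
        by blast
    qed
  qed
  then have C: "tensor_Cauchy UNIV UNIV u"
    by (simp add: tensor_Cauchy_def Cauchy_iff norm_ptensor_of_formal flip: ptensor_of_formal_diff)
  have "(\<lambda>n. (X n - ptensor_of_formal (u n)) + ptensor_of_formal (u n)) \<longlonglongrightarrow> 0 + abs_ptensor u"
    by (intro tendsto_add lim0 ptensor_of_formal_tendsto C)
  then show "convergent X" by (auto simp: convergent_def)
qed

lemma elementary_tensor_bilinear: "bilinear_on UNIV UNIV (\<otimes>\<^sub>\<gamma>)"
proof -
  have *: "ptensor_of_formal u = ptensor_of_formal v" if "u - v \<in> bilinear_relators UNIV UNIV" for u v
    using ptensor_of_formal_null[OF tensor_null_base[OF that]] by (simp add: ptensor_of_formal_diff)
  show ?thesis
    unfolding bilinear_on_def elementary_tensor_def ptensor_of_formal_add[symmetric] ptensor_of_formal_scaleC[symmetric]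
  proof (intro conjI ballI allI)
    fix a a' b show "ptensor_of_formal (formal_tensor (a + a') b) = ptensor_of_formal (formal_tensor a b + formal_tensor a' b)"
      by (rule *) (unfold bilinear_relators_def diff_diff_eq[symmetric], blast)
  next
    fix a b b' show "ptensor_of_formal (formal_tensor a (b + b')) = ptensor_of_formal (formal_tensor a b + formal_tensor a b')"
      by (rule *) (unfold bilinear_relators_def diff_diff_eq[symmetric], blast)
  next
    fix c a b
    show "ptensor_of_formal (formal_tensor (c *\<^sub>C a) b) = ptensor_of_formal (c *\<^sub>C formal_tensor a b)"
      "ptensor_of_formal (formal_tensor a (c *\<^sub>C b)) = ptensor_of_formal (c *\<^sub>C formal_tensor a b)"
      by (rule *; unfold bilinear_relators_def, blast)+
  qed
qed

lemma norm_elementary_tensor_le: "norm (a \<otimes>\<^sub>\<gamma> b) \<le> norm a * norm b"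
  by (simp add: elementary_tensor_def norm_ptensor_of_formal proj_norm_formal_tensor)

lemma ptensor_of_formal_linear_extension: "ptensor_of_formal u = linear_extension (\<lambda>(a, b). a \<otimes>\<^sub>\<gamma> b) u"
proof -
  have "ptensor_of_formal (\<Sum>k\<in>S. Poly_Mapping.lookup u k *\<^sub>C Poly_Mapping.single k 1)
      = (\<Sum>k\<in>S. Poly_Mapping.lookup u k *\<^sub>C (case k of (a, b) \<Rightarrow> a \<otimes>\<^sub>\<gamma> b))" if "finite S" for S
    using that
    by (induction S) (auto simp: ptensor_of_formal_add ptensor_of_formal_scaleC ptensor_of_formal_null
        tensor_null_0 elementary_tensor_def formal_tensor_def)
  from this[of "Poly_Mapping.keys u"] show ?thesis
    using linear_extension_single_id[of u] by (simp add: linear_extension_def)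
qed

lemma cblinfun_ptensor_eqI:
  fixes S T :: "('a::complex_normed_vector, 'b::complex_normed_vector) ptensor \<Rightarrow>\<^sub>C\<^sub>L 'v::complex_normed_vector"
  assumes eq: "\<And>a b. S (a \<otimes>\<^sub>\<gamma> b) = T (a \<otimes>\<^sub>\<gamma> b)"
  shows "S = T"
proof (rule cblinfun_eqI)
  fix x :: "('a, 'b) ptensor"
  obtain s where x: "x = abs_ptensor s" and s: "tensor_Cauchy UNIV UNIV s" by (rule ptensor_cases)
  have F: "F (ptensor_of_formal u) = linear_extension (\<lambda>(a, b). F (a \<otimes>\<^sub>\<gamma> b)) u"
    for F :: "('a, 'b) ptensor \<Rightarrow>\<^sub>C\<^sub>L 'v" and u
    unfolding ptensor_of_formal_linear_extension linear_extension_def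
      linear_sum[OF bounded_linear.linear[OF bounded_linear_cblinfun_apply]] cblinfun_scaleC_right
    by (simp add: case_prod_unfold)
  have "(\<lambda>n. F (ptensor_of_formal (s n))) \<longlonglongrightarrow> F x" for F :: "('a, 'b) ptensor \<Rightarrow>\<^sub>C\<^sub>L 'v"
    unfolding x by (rule bounded_linear.tendsto[OF bounded_linear_cblinfun_apply ptensor_of_formal_tendsto[OF s]])
  from this[of S] this[of T] show "S x = T x"
    unfolding F eq by (rule LIMSEQ_unique)
qed

text \<open>Bounded bilinear maps factor through the completed projective tensor product.\<close>

lemma ex_ptensor_lift:
  fixes h :: "'a::complex_normed_vector \<Rightarrow> 'b::complex_normed_vector \<Rightarrow> 'v::complex_banach"
  assumes h: "bilinear_on UNIV UNIV h" and K: "0 \<le> K" "\<And>a b. norm (h a b) \<le> K * (norm a * norm b)"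
  shows "\<exists>T :: ('a, 'b) ptensor \<Rightarrow>\<^sub>C\<^sub>L 'v. (\<forall>a b. cblinfun_apply T (a \<otimes>\<^sub>\<gamma> b) = h a b) \<and> norm T \<le> K"
proof -
  note U = complex_vector.subspace_UNIV
  define H where "H = linear_extension (\<lambda>(a, b). h a b)"
  have H_simps: "H (u + v) = H u + H v" "H (u - v) = H u - H v" "H (c *\<^sub>C u) = c *\<^sub>C H u" for u v c
    by (simp_all add: H_def linear_extension_add linear_extension_diff linear_extension_scaleC)
  have H_le: "norm (H u) \<le> K * proj_norm UNIV UNIV u" for u
    unfolding H_def by (rule norm_linear_extension_le[OF U formal_sums_UNIV h K])
  define g where "g x = lim (\<lambda>n. H (rep_ptensor x n))" for x :: "('a, 'b) ptensor"
  have g: "(\<lambda>n. H (s n)) \<longlonglongrightarrow> g (abs_ptensor s)" if s: "tensor_Cauchy UNIV UNIV s" for s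
  proof -
    let ?r = "rep_ptensor (abs_ptensor s)"
    have "ptensor_rel UNIV UNIV ?r s"
      using s by (simp add: Quotient_rep_abs[OF Quotient_ptensor] ptensor_rel_self_iff)
    then have r: "tensor_Cauchy UNIV UNIV ?r" and rs: "(\<lambda>n. proj_norm UNIV UNIV (?r n - s n)) \<longlonglongrightarrow> 0"
      by (auto simp: ptensor_rel_def)
    have "Cauchy (\<lambda>n. H (?r n))"
    proof (rule CauchyI)
      fix e :: real assume "0 < e"
      then have "0 < e / (K + 1)" using K(1) by simp
      then obtain N where N: "\<And>m n. m \<ge> N \<Longrightarrow> n \<ge> N \<Longrightarrow> proj_norm UNIV UNIV (?r m - ?r n) < e / (K + 1)"
        using r unfolding tensor_Cauchy_def by meson
      have "norm (H (?r m) - H (?r n)) < e" if "m \<ge> N" "n \<ge> N" for m n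
      proof -
        have "norm (H (?r m) - H (?r n)) \<le> K * proj_norm UNIV UNIV (?r m - ?r n)"
          using H_le[of "?r m - ?r n"] by (simp add: H_simps)
        also have "\<dots> \<le> K * (e / (K + 1))"
          using N[OF that] K(1) by (intro mult_left_mono) auto
        also have "\<dots> < e"
          using \<open>0 < e\<close> K(1) by (simp add: field_simps)
        finally show ?thesis .
      qed
      then show "\<exists>M. \<forall>m\<ge>M. \<forall>n\<ge>M. norm (H (?r m) - H (?r n)) < e" by blast
    qed
    then have 1: "(\<lambda>n. H (?r n)) \<longlonglongrightarrow> g (abs_ptensor s)"
      by (simp add: g_def Cauchy_convergent_iff convergent_LIMSEQ_iff)
    have 2: "(\<lambda>n. H (?r n) - H (s n)) \<longlonglongrightarrow> 0"
    proof (rule Lim_null_comparison)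
      show "\<forall>\<^sub>F n in sequentially. norm (H (?r n) - H (s n)) \<le> K * proj_norm UNIV UNIV (?r n - s n)"
        using H_le by (auto intro!: always_eventually simp flip: H_simps)
      show "(\<lambda>n. K * proj_norm UNIV UNIV (?r n - s n)) \<longlonglongrightarrow> 0"
        by (rule tendsto_mult_right_zero[OF rs])
    qed
    from tendsto_diff[OF 1 2] show ?thesis by simp
  qed
  have add: "g (x + y) = g x + g y" for x y
  proof -
    obtain s t where x: "x = abs_ptensor s" and s: "tensor_Cauchy UNIV UNIV s"
      and y: "y = abs_ptensor t" and t: "tensor_Cauchy UNIV UNIV t" by (metis ptensor_cases)
    have "(\<lambda>n. H (s n + t n)) \<longlonglongrightarrow> g (x + y)"
      using g[OF tensor_Cauchy_add[OF U s t]] by (simp add: x y abs_ptensor_ops s t)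
    moreover have "(\<lambda>n. H (s n + t n)) \<longlonglongrightarrow> g x + g y"
      unfolding H_simps x y by (intro tendsto_add g s t)
    ultimately show ?thesis by (rule LIMSEQ_unique)
  qed
  have sc: "g (c *\<^sub>C x) = c *\<^sub>C g x" for c x
  proof -
    obtain s where x: "x = abs_ptensor s" and s: "tensor_Cauchy UNIV UNIV s" by (metis ptensor_cases)
    have "(\<lambda>n. H (c *\<^sub>C s n)) \<longlonglongrightarrow> g (c *\<^sub>C x)"
      using g[OF tensor_Cauchy_scaleC[OF U s]] by (simp add: x abs_ptensor_ops s)
    moreover have "(\<lambda>n. H (c *\<^sub>C s n)) \<longlonglongrightarrow> c *\<^sub>C g x"
      unfolding H_simps x by (rule bounded_linear.tendsto[OF bounded_linear_scaleC_right g[OF s]])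
    ultimately show ?thesis by (rule LIMSEQ_unique)
  qed
  have le: "norm (g x) \<le> K * norm x" for x
  proof -
    obtain s where x: "x = abs_ptensor s" and s: "tensor_Cauchy UNIV UNIV s" by (metis ptensor_cases)
    show ?thesis
      unfolding x
      by (rule LIMSEQ_le[OF tendsto_norm[OF g[OF s]] tendsto_mult_left[OF tendsto_norm_abs_ptensor[OF s]]])
        (use H_le in blast)
  qed
  obtain T :: "('a, 'b) ptensor \<Rightarrow>\<^sub>C\<^sub>L 'v" where T: "cblinfun_apply T = g"
    using ex_cblinfun[of g, OF add sc le] by blast
  have "g (a \<otimes>\<^sub>\<gamma> b) = h a b" for a b
  proof -
    have "(\<lambda>_. h a b) \<longlonglongrightarrow> g (a \<otimes>\<^sub>\<gamma> b)"
      using g[OF tensor_Cauchy_UNIV_const, of "formal_tensor a b"]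
      by (simp add: H_def elementary_tensor_def ptensor_of_formal_def)
    then show ?thesis by (simp add: LIMSEQ_const_iff)
  qed
  moreover have "norm T \<le> K"
    using le by (intro norm_cblinfun_bound[OF K(1)]) (simp add: T)
  ultimately show ?thesis using T by auto
qed

text \<open>
  The map \<open>A \<otimes> B \<rightarrow> UNIV \<otimes> UNIV\<close> induced by the two inclusions.  It need not be injective:
  an element may vanish in the larger tensor product only.
\<close>

definition ptensor_inclusion ::
  "(nat \<Rightarrow> ('a::complex_normed_vector, 'b::complex_normed_vector) formal_sum) set \<Rightarrow> ('a, 'b) ptensor"
  where "ptensor_inclusion M = the_elem (abs_ptensor ` M)"

lemma bounded_clinear_id: "bounded_clinear id"
  by (simp add: bounded_clinear_def bounded_linear_ident id_def)

lemma ptensor_inclusion_class: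
  assumes A: "csubspace A" and s: "tensor_Cauchy A B s"
  shows "tensor_Cauchy UNIV UNIV s" and "ptensor_inclusion (ptensor_class A B s) = abs_ptensor s"
proof -
  note * = ptensor_rel_formal_map[OF A complex_vector.subspace_UNIV bounded_clinear_id subset_UNIV
      bounded_clinear_id subset_UNIV, unfolded formal_map_id]
  show C: "tensor_Cauchy UNIV UNIV s" by (rule *(1)[OF s])
  have "abs_ptensor t = abs_ptensor s" if "t \<in> ptensor_class A B s" for t
  proof -
    have "ptensor_rel UNIV UNIV s t"
      using *(2)[OF s] that by (simp add: ptensor_class_def)
    then show ?thesis
      using C abs_ptensor_eq_iff[of s t] by (simp add: ptensor_rel_def)
  qed
  moreover have "s \<in> ptensor_class A B s"
    using ptensor_rel_refl[OF A s] by (simp add: ptensor_class_def)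
  ultimately have "abs_ptensor ` ptensor_class A B s = {abs_ptensor s}" by blast
  then show "ptensor_inclusion (ptensor_class A B s) = abs_ptensor s"
    by (simp add: ptensor_inclusion_def)
qed


section \<open>Hyper-commutators\<close>

text \<open>
  The bimodule operations \<open>c (a \<otimes> b) = (c a) \<otimes> b\<close> and \<open>(a \<otimes> b) c = a \<otimes> (b c)\<close>; see
  \<open>action_class\<close> and \<open>action_elementary\<close>.
\<close>

definition left_action :: "('x::complex_banach \<Rightarrow>\<^sub>C\<^sub>L 'x) set \<Rightarrow> ('x \<Rightarrow>\<^sub>C\<^sub>L 'x)
    \<Rightarrow> (nat \<Rightarrow> ('x \<Rightarrow>\<^sub>C\<^sub>L 'x, 'x \<Rightarrow>\<^sub>C\<^sub>L 'x) formal_sum) set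
    \<Rightarrow> (nat \<Rightarrow> ('x \<Rightarrow>\<^sub>C\<^sub>L 'x, 'x \<Rightarrow>\<^sub>C\<^sub>L 'x) formal_sum) set"
  where "left_action A c M = ptensor_map A A (\<lambda>a. c o\<^sub>C\<^sub>L a) id M"

definition right_action :: "('x::complex_banach \<Rightarrow>\<^sub>C\<^sub>L 'x) set \<Rightarrow> ('x \<Rightarrow>\<^sub>C\<^sub>L 'x)
    \<Rightarrow> (nat \<Rightarrow> ('x \<Rightarrow>\<^sub>C\<^sub>L 'x, 'x \<Rightarrow>\<^sub>C\<^sub>L 'x) formal_sum) set
    \<Rightarrow> (nat \<Rightarrow> ('x \<Rightarrow>\<^sub>C\<^sub>L 'x, 'x \<Rightarrow>\<^sub>C\<^sub>L 'x) formal_sum) set"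
  where "right_action A c M = ptensor_map A A id (\<lambda>b. b o\<^sub>C\<^sub>L c) M"

definition hyper_commutator :: "('x::complex_banach \<Rightarrow>\<^sub>C\<^sub>L 'x) set
    \<Rightarrow> (nat \<Rightarrow> ('x \<Rightarrow>\<^sub>C\<^sub>L 'x, 'x \<Rightarrow>\<^sub>C\<^sub>L 'x) formal_sum) set \<Rightarrow> bool"
  where "hyper_commutator A M \<longleftrightarrow>
    M \<in> ptensor_space A A \<and> (\<forall>a\<in>A. left_action A a M = right_action A a M)"

lemma norm_cblinfun_compose: "norm (S o\<^sub>C\<^sub>L T) \<le> norm S * norm T"
  by transfer (rule norm_blinfun_compose)

lemma bounded_clinear_compose_left: "bounded_clinear (\<lambda>a. c o\<^sub>C\<^sub>L a)"
  unfolding bounded_clinear_def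
proof (intro conjI allI)
  show "bounded_linear (\<lambda>a. c o\<^sub>C\<^sub>L a)"
    by (rule bounded_linear_intro[of _ "norm c"])
      (auto intro!: cblinfun_eqI simp: cblinfun_compose_apply cblinfun_apply_simps cblinfun_apply_add
        scaleR_scaleC scaleC_cblinfun_apply cblinfun_scaleC_right mult.commute[of _ "norm c"] norm_cblinfun_compose)
  show "c o\<^sub>C\<^sub>L (d *\<^sub>C a) = d *\<^sub>C (c o\<^sub>C\<^sub>L a)" for d a
    by (rule cblinfun_eqI) (simp add: cblinfun_compose_apply scaleC_cblinfun_apply cblinfun_scaleC_right)
qed

lemma bounded_clinear_compose_right: "bounded_clinear (\<lambda>b. b o\<^sub>C\<^sub>L c)"
  unfolding bounded_clinear_def
proof (intro conjI allI)
  show "bounded_linear (\<lambda>b. b o\<^sub>C\<^sub>L c)"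
    by (rule bounded_linear_intro[of _ "norm c"])
      (auto intro!: cblinfun_eqI simp: cblinfun_compose_apply cblinfun_apply_simps norm_cblinfun_compose)
  show "(d *\<^sub>C b) o\<^sub>C\<^sub>L c = d *\<^sub>C (b o\<^sub>C\<^sub>L c)" for d b
    by (rule cblinfun_eqI) (simp add: cblinfun_compose_apply scaleC_cblinfun_apply)
qed

lemma action_class:
  assumes A: "banach_subalgebra A" and c: "c \<in> A" and s: "tensor_Cauchy A A s"
  shows "left_action A c (ptensor_class A A s) = ptensor_class A A (\<lambda>n. formal_map (\<lambda>a. c o\<^sub>C\<^sub>L a) id (s n))"
    and "right_action A c (ptensor_class A A s) = ptensor_class A A (\<lambda>n. formal_map id (\<lambda>b. b o\<^sub>C\<^sub>L c) (s n))"
    and "left_action A c (ptensor_class A A s) \<in> ptensor_space A A"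
    and "right_action A c (ptensor_class A A s) \<in> ptensor_space A A"
proof -
  have S: "csubspace A" using A by (simp add: banach_subalgebra_def)
  have L: "(\<lambda>a. c o\<^sub>C\<^sub>L a) ` A \<subseteq> A" and R: "(\<lambda>b. b o\<^sub>C\<^sub>L c) ` A \<subseteq> A" and I: "id ` A \<subseteq> A"
    using A c by (auto simp: banach_subalgebra_def)
  show l: "left_action A c (ptensor_class A A s) = ptensor_class A A (\<lambda>n. formal_map (\<lambda>a. c o\<^sub>C\<^sub>L a) id (s n))"
    unfolding left_action_def
    by (rule ptensor_map_class[OF S S bounded_clinear_compose_left L bounded_clinear_id I s])
  show r: "right_action A c (ptensor_class A A s) = ptensor_class A A (\<lambda>n. formal_map id (\<lambda>b. b o\<^sub>C\<^sub>L c) (s n))"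
    unfolding right_action_def
    by (rule ptensor_map_class[OF S S bounded_clinear_id I bounded_clinear_compose_right R s])
  show "left_action A c (ptensor_class A A s) \<in> ptensor_space A A"
    using ptensor_rel_formal_map(1)[OF S S bounded_clinear_compose_left L bounded_clinear_id I s]
    unfolding l ptensor_space_def by blast
  show "right_action A c (ptensor_class A A s) \<in> ptensor_space A A"
    using ptensor_rel_formal_map(1)[OF S S bounded_clinear_id I bounded_clinear_compose_right R s]
    unfolding r ptensor_space_def by blast
qed

lemma action_elementary:
  assumes "banach_subalgebra A" "c \<in> A" "a \<in> A" "b \<in> A"
  shows "left_action A c (ptensor_class A A (\<lambda>_. formal_tensor a b)) = ptensor_class A A (\<lambda>_. formal_tensor (c o\<^sub>C\<^sub>L a) b)"
    and "right_action A c (ptensor_class A A (\<lambda>_. formal_tensor a b)) = ptensor_class A A (\<lambda>_. formal_tensor a (b o\<^sub>C\<^sub>L c))"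
  using action_class[OF assms(1,2) tensor_Cauchy_const[OF _ formal_tensor_in[OF assms(3,4)]]] assms(1)
  by (simp_all add: banach_subalgebra_def formal_map_def)


section \<open>The canonical morphism into the operators on the tensor square\<close>

text \<open>Existence and uniqueness are \<open>ex1_Upsilon\<close> below.\<close>

definition Upsilon :: "('x::complex_banach \<Rightarrow>\<^sub>C\<^sub>L 'x, 'x \<Rightarrow>\<^sub>C\<^sub>L 'x) ptensor
    \<Rightarrow>\<^sub>C\<^sub>L (('x, 'x) ptensor \<Rightarrow>\<^sub>C\<^sub>L ('x, 'x) ptensor)"
  where "Upsilon = (THE U. \<forall>T S x y.
    cblinfun_apply (cblinfun_apply U (T \<otimes>\<^sub>\<gamma> S)) (x \<otimes>\<^sub>\<gamma> y) = cblinfun_apply T x \<otimes>\<^sub>\<gamma> cblinfun_apply S y)"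

lemma ex1_Upsilon:
  "\<exists>!U :: ('x::complex_banach \<Rightarrow>\<^sub>C\<^sub>L 'x, 'x \<Rightarrow>\<^sub>C\<^sub>L 'x) ptensor
      \<Rightarrow>\<^sub>C\<^sub>L (('x, 'x) ptensor \<Rightarrow>\<^sub>C\<^sub>L ('x, 'x) ptensor).
    \<forall>T S x y. cblinfun_apply (cblinfun_apply U (T \<otimes>\<^sub>\<gamma> S)) (x \<otimes>\<^sub>\<gamma> y) = cblinfun_apply T x \<otimes>\<^sub>\<gamma> cblinfun_apply S y"
proof (rule ex_ex1I)
  note bil = elementary_tensor_bilinear[unfolded bilinear_on_def, simplified]
  have "\<exists>P :: ('x, 'x) ptensor \<Rightarrow>\<^sub>C\<^sub>L ('x, 'x) ptensor.
      (\<forall>x y. cblinfun_apply P (x \<otimes>\<^sub>\<gamma> y) = cblinfun_apply T x \<otimes>\<^sub>\<gamma> cblinfun_apply S y) \<and> norm P \<le> norm T * norm S"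
    for T S :: "'x \<Rightarrow>\<^sub>C\<^sub>L 'x"
  proof (rule ex_ptensor_lift)
    show "bilinear_on UNIV UNIV (\<lambda>x y. cblinfun_apply T x \<otimes>\<^sub>\<gamma> cblinfun_apply S y)"
      by (simp add: bilinear_on_def cblinfun_apply_add cblinfun_scaleC_right bil)
    fix x y
    have "norm (cblinfun_apply T x \<otimes>\<^sub>\<gamma> cblinfun_apply S y) \<le> norm (cblinfun_apply T x) * norm (cblinfun_apply S y)"
      by (rule norm_elementary_tensor_le)
    also have "\<dots> \<le> (norm T * norm x) * (norm S * norm y)"
      by (intro mult_mono norm_cblinfun_apply) auto
    finally show "norm (cblinfun_apply T x \<otimes>\<^sub>\<gamma> cblinfun_apply S y) \<le> norm T * norm S * (norm x * norm y)"
      by (simp add: mult.assoc mult.left_commute)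
  qed simp
  then obtain P :: "('x \<Rightarrow>\<^sub>C\<^sub>L 'x) \<Rightarrow> ('x \<Rightarrow>\<^sub>C\<^sub>L 'x) \<Rightarrow> ('x, 'x) ptensor \<Rightarrow>\<^sub>C\<^sub>L ('x, 'x) ptensor"
    where P: "\<And>T S x y. cblinfun_apply (P T S) (x \<otimes>\<^sub>\<gamma> y) = cblinfun_apply T x \<otimes>\<^sub>\<gamma> cblinfun_apply S y"
      and P_le: "\<And>T S. norm (P T S) \<le> norm T * norm S"
    by metis
  have "\<exists>U :: ('x \<Rightarrow>\<^sub>C\<^sub>L 'x, 'x \<Rightarrow>\<^sub>C\<^sub>L 'x) ptensor \<Rightarrow>\<^sub>C\<^sub>L (('x, 'x) ptensor \<Rightarrow>\<^sub>C\<^sub>L ('x, 'x) ptensor).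
      (\<forall>T S. cblinfun_apply U (T \<otimes>\<^sub>\<gamma> S) = P T S) \<and> norm U \<le> 1"
  proof (rule ex_ptensor_lift)
    show "bilinear_on UNIV UNIV P"
      unfolding bilinear_on_def
      by (intro conjI ballI allI; rule cblinfun_ptensor_eqI;
          simp add: P cblinfun_apply_simps scaleC_cblinfun_apply bil)
  qed (use P_le in auto)
  then show "\<exists>U :: ('x \<Rightarrow>\<^sub>C\<^sub>L 'x, 'x \<Rightarrow>\<^sub>C\<^sub>L 'x) ptensor \<Rightarrow>\<^sub>C\<^sub>L (('x, 'x) ptensor \<Rightarrow>\<^sub>C\<^sub>L ('x, 'x) ptensor).
      \<forall>T S x y. cblinfun_apply (cblinfun_apply U (T \<otimes>\<^sub>\<gamma> S)) (x \<otimes>\<^sub>\<gamma> y) = cblinfun_apply T x \<otimes>\<^sub>\<gamma> cblinfun_apply S y"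
    using P by metis
qed (rule cblinfun_ptensor_eqI, rule cblinfun_ptensor_eqI, simp)

lemma Upsilon_elementary:
  "cblinfun_apply (cblinfun_apply Upsilon (T \<otimes>\<^sub>\<gamma> S)) (x \<otimes>\<^sub>\<gamma> y) = cblinfun_apply T x \<otimes>\<^sub>\<gamma> cblinfun_apply S y"
  using theI'[OF ex1_Upsilon] unfolding Upsilon_def by blast

end

(* Let W be the image of M.  Applied to rank-one operators of A, the hyper-commutator identity says
   that W (x \<otimes> z) = z \<otimes> v with v depending on x only, so for a bounded functional \<psi> the slice
   z \<mapsto> (id \<otimes> \<psi>) (W (x \<otimes> z)) is \<psi>(v) times the identity.  This slice is also a norm limit of
   operators of finite rank, because M is a limit of finite sums of elementary tensors.  In infinite
   dimension this forces \<psi>(v) = 0, and \<psi> was arbitrary. *)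
theory Submission
  imports Defs
begin

section \<open>Separation of points by bounded functionals\<close>

definition sublinear :: "('a::real_vector \<Rightarrow> real) \<Rightarrow> bool"
  where "sublinear p \<longleftrightarrow> (\<forall>x y. p (x + y) \<le> p x + p y) \<and> (\<forall>r x. 0 \<le> r \<longrightarrow> p (r *\<^sub>R x) = r * p x)"

lemma sublinear_add: "sublinear p \<Longrightarrow> p (x + y) \<le> p x + p y"
  and sublinear_scaleR: "sublinear p \<Longrightarrow> 0 \<le> r \<Longrightarrow> p (r *\<^sub>R x) = r * p x"
  by (simp_all add: sublinear_def)

lemma sublinear_0: "sublinear p \<Longrightarrow> p 0 = 0"
  using sublinear_scaleR[of p 0 0] by simp

lemma sublinear_minus_ge: "sublinear p \<Longrightarrow> - p (- x) \<le> p x"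
  using sublinear_add[of p x "- x"] sublinear_0[of p] by simp

text \<open>The reverse inequality comes from applying \<open>scale\<close> with
  \<open>inverse r\<close> at \<open>r *\<^sub>R x\<close>. A functional defined as an infimum thus
  needs only upper estimates.\<close>

lemma sublinearI:
  assumes add: "\<And>x y. p (x + y) \<le> p x + p y" and zero: "p 0 = 0"
    and scale: "\<And>r x. 0 < r \<Longrightarrow> p (r *\<^sub>R x) \<le> r * p x"
  shows "sublinear p"
  unfolding sublinear_def
proof (intro conjI allI impI add)
  fix r :: real and x assume "0 \<le> r"
  show "p (r *\<^sub>R x) = r * p x"
  proof (cases "r = 0")
    case True
    then show ?thesis by (simp add: zero)
  next
    case False
    with \<open>0 \<le> r\<close> have r: "0 < r" by simp
    have "p (inverse r *\<^sub>R r *\<^sub>R x) \<le> inverse r * p (r *\<^sub>R x)"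
      using r by (intro scale) simp
    then have "r * p x \<le> p (r *\<^sub>R x)"
      using r by (simp add: field_simps)
    with scale[OF r, of x] show ?thesis by simp
  qed
qed

lemma sublinear_norm: "sublinear norm"
  by (simp add: sublinear_def norm_triangle_ineq)

text \<open>
  The Hahn-Banach theorem is obtained from a minimal sublinear functional below a given one:
  by the next lemma a minimal \<open>p\<close> satisfies \<open>p (- z) \<le> - p z\<close>, and is therefore linear.
\<close>

lemma sublinear_reduce:
  assumes p: "sublinear p"
  shows "\<exists>q. sublinear q \<and> (\<forall>x. q x \<le> p x) \<and> q (- z) \<le> - p z"
proof -
  \<comment> \<open>The infimum over \<open>t\<close> is the reduced functional:
    \<open>t = 0\<close> gives \<open>q \<le> p\<close>, and \<open>t = 1\<close> at
    \<open>- z\<close> gives \<open>p 0 - p z\<close>.\<close>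
  define d where "d x t = p (x + t *\<^sub>R z) - t * p z" for x t
  define q where "q x = (INF t\<in>{0..}. d x t)" for x
  \<comment> \<open>A bound independent of \<open>t\<close>, from
    \<open>t * p z = p (t *\<^sub>R z)\<close> and subadditivity; it makes the infimum
    finite.\<close>
  have lower: "- p (- x) \<le> d x t" if "0 \<le> t" for x t
    using sublinear_add[OF p, of "x + t *\<^sub>R z" "- x"] sublinear_scaleR[OF p that, of z] by (simp add: d_def)
  have q_le: "q x \<le> d x t" if "0 \<le> t" for x t
    unfolding q_def by (rule cINF_lower) (use that lower in \<open>auto intro!: bdd_belowI2\<close>)
  have q_ge: "b \<le> q x" if "\<And>t. 0 \<le> t \<Longrightarrow> b \<le> d x t" for b x
    unfolding q_def by (rule cINF_greatest) (use that in auto)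
  have "sublinear q"
  proof (rule sublinearI)
    fix x y
    \<comment> \<open>The infima for \<open>x\<close> and \<open>y\<close> are taken one after the
      other, with separate parameters whose sum serves for \<open>x + y\<close>.\<close>
    have "q (x + y) - d y t \<le> d x s" if "0 \<le> s" "0 \<le> t" for s t
    proof -
      have "q (x + y) \<le> d (x + y) (s + t)"
        using that by (intro q_le) simp
      also have "\<dots> \<le> d x s + d y t"
        using sublinear_add[OF p, of "x + s *\<^sub>R z" "y + t *\<^sub>R z"] by (simp add: d_def algebra_simps)
      finally show ?thesis by simp
    qed
    then have "q (x + y) - q x \<le> d y t" if "0 \<le> t" for t
      using q_ge[of "q (x + y) - d y t" x] that by force
    then show "q (x + y) \<le> q x + q y"
      using q_ge[of "q (x + y) - q x" y] by force
  next
    show "q 0 = 0"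
      using q_le[of 0 0] q_ge[of 0 0] by (force simp: d_def sublinear_0[OF p] sublinear_scaleR[OF p])
  next
    fix r :: real and x assume r: "0 < r"
    have "q (r *\<^sub>R x) / r \<le> d x t" if "0 \<le> t" for t
    proof -
      have "q (r *\<^sub>R x) \<le> d (r *\<^sub>R x) (r * t)"
        using r that by (intro q_le) simp
      also have "\<dots> = r * d x t"
        using sublinear_scaleR[OF p, of r "x + t *\<^sub>R z"] r by (simp add: d_def algebra_simps)
      finally show ?thesis using r by (simp add: field_simps)
    qed
    from q_ge[OF this] r show "q (r *\<^sub>R x) \<le> r * q x"
      by (simp add: field_simps)
  qed
  moreover have "q x \<le> p x" for x
    using q_le[of 0 x] by (simp add: d_def)
  moreover have "q (- z) \<le> - p z"
    using q_le[of 1 "- z"] by (simp add: d_def sublinear_0[OF p])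
  ultimately show ?thesis by blast
qed

text \<open>Provides the bounds of chains for Zorn's lemma. All members lie above
  \<open>- p0 (- x)\<close> at \<open>x\<close>, so the pointwise infimum is finite; for
  subadditivity, two members are replaced by the smaller one.\<close>

lemma sublinear_chain_INF:
  assumes ne: "C \<noteq> {}" and C: "\<And>p. p \<in> C \<Longrightarrow> sublinear p \<and> p \<le> p0"
    and chain: "\<And>p q. p \<in> C \<Longrightarrow> q \<in> C \<Longrightarrow> p \<le> q \<or> q \<le> p"
  shows "sublinear (\<lambda>x. INF p\<in>C. p x)" and "p \<in> C \<Longrightarrow> (INF p\<in>C. p x) \<le> p x"
proof -
  define q where "q x = (INF p\<in>C. p x)" for x
  have "- p0 (- x) \<le> p x" if "p \<in> C" for p x
  proof -
    have "p (- x) \<le> p0 (- x)" and "- p (- x) \<le> p x"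
      using C[OF that] sublinear_minus_ge[of p x] by (auto simp: le_fun_def)
    then show ?thesis by simp
  qed
  then have q_le: "q x \<le> p x" if "p \<in> C" for p x
    unfolding q_def by (intro cINF_lower) (use that in \<open>auto intro!: bdd_belowI2\<close>)
  then show "p \<in> C \<Longrightarrow> (INF p\<in>C. p x) \<le> p x"
    by (simp add: q_def)
  have q_ge: "b \<le> q x" if "\<And>p. p \<in> C \<Longrightarrow> b \<le> p x" for b x
    unfolding q_def by (rule cINF_greatest) (use that ne in auto)
  have "sublinear q"
  proof (rule sublinearI)
    fix x y
    have "q (x + y) - p2 y \<le> p1 x" if p12: "p1 \<in> C" "p2 \<in> C" for p1 p2
    proof -
      obtain p where p: "p \<in> C" "p \<le> p1" "p \<le> p2"
        using chain[OF p12] p12 by blast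
      have "q (x + y) \<le> p (x + y)" by (rule q_le[OF p(1)])
      also have "\<dots> \<le> p x + p y" using C[OF p(1)] by (simp add: sublinear_add)
      also have "\<dots> \<le> p1 x + p2 y" using p by (simp add: le_fun_def add_mono)
      finally show ?thesis by simp
    qed
    then have "q (x + y) - q x \<le> p y" if "p \<in> C" for p
      using q_ge[of "q (x + y) - p y" x] that by force
    then show "q (x + y) \<le> q x + q y"
      using q_ge[of "q (x + y) - q x" y] by force
  next
    have "q 0 = (INF p\<in>C. 0)"
      unfolding q_def using C by (intro INF_cong) (auto simp: sublinear_0)
    then show "q 0 = 0" using ne by simp
  next
    fix r :: real and x assume r: "0 < r"
    have "q (r *\<^sub>R x) / r \<le> p x" if "p \<in> C" for p
      using q_le[OF that, of "r *\<^sub>R x"] C[OF that] r by (simp add: sublinear_scaleR field_simps)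
    from q_ge[OF this] r show "q (r *\<^sub>R x) \<le> r * q x"
      by (simp add: field_simps)
  qed
  then show "sublinear (\<lambda>x. INF p\<in>C. p x)"
    by (simp add: q_def[abs_def])
qed

lemma sublinear_dominates_linear:
  assumes p0: "sublinear p0"
  shows "\<exists>f. linear f \<and> (\<forall>x. f x \<le> p0 x)"
proof -
  let ?A = "{p. sublinear p \<and> p \<le> p0}"
  have "\<exists>m\<in>?A. \<forall>p\<in>?A. p \<le> m \<longrightarrow> p = m"
  \<comment> \<open>The order is reversed, so a maximal element is a minimal sublinear functional
    and chains are bounded by their pointwise infimum, the empty one by \<open>p0\<close>.\<close>
  proof (rule predicate_Zorn[of ?A "\<lambda>p q. q \<le> p"])
    show "partial_order_on ?A (relation_of (\<lambda>p q. q \<le> p) ?A)"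
      by (rule partial_order_on_relation_ofI) auto
    fix C assume "C \<in> Chains (relation_of (\<lambda>p q. q \<le> p) ?A)"
    then have C: "sublinear p \<and> p \<le> p0" and ch: "p \<le> q \<or> q \<le> p" if "p \<in> C" "q \<in> C" for p q
      using that by (auto simp: Chains_def relation_of_def)
    show "\<exists>u\<in>?A. \<forall>a\<in>C. u \<le> a"
    proof (cases "C = {}")
      case True
      then show ?thesis using p0 by auto
    next
      case False
      then obtain p where p: "p \<in> C" by blast
      note * = sublinear_chain_INF[OF False C ch]
      have "(\<lambda>x. INF p\<in>C. p x) \<le> a" if "a \<in> C" for a
        using *(2)[OF _ _ _ _ that] by (simp add: le_fun_def)
      then show ?thesis
        using *(1) C[OF p p] p by (intro bexI[of _ "\<lambda>x. INF p\<in>C. p x"]) (auto intro: order_trans)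
    qed
  qed
  then obtain f where f: "sublinear f" "f \<le> p0"
    and minimal: "\<And>p. sublinear p \<Longrightarrow> p \<le> f \<Longrightarrow> p = f"
    by (auto intro: order_trans)
  have minus: "f (- z) = - f z" for z
  proof -
    obtain q where q: "sublinear q" "\<forall>x. q x \<le> f x" "q (- z) \<le> - f z"
      using sublinear_reduce[OF f(1)] by blast
    with minimal[of q] have "f (- z) \<le> - f z" by (simp add: le_fun_def)
    with sublinear_minus_ge[OF f(1), of z] show ?thesis by simp
  qed
  \<comment> \<open>Oddness finishes the argument: subadditivity at \<open>x + y\<close> and
    \<open>- y\<close> gives superadditivity, and negative scalars reduce to positive ones.\<close>
  have "linear f"
  proof (rule linearI)
    show "f (x + y) = f x + f y" for x y
      using sublinear_add[OF f(1), of x y] sublinear_add[OF f(1), of "x + y" "- y"] minus[of y] by simp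
    show "f (r *\<^sub>R x) = r *\<^sub>R f x" for r x
      using sublinear_scaleR[OF f(1), of r x] sublinear_scaleR[OF f(1), of "- r" x] minus[of "r *\<^sub>R x"]
      by (cases "0 \<le> r") auto
  qed
  with f(2) show ?thesis by (auto simp: le_fun_def)
qed

text \<open>Reducing the norm in direction \<open>y\<close> before linearizing forces the value at
  \<open>y\<close>: a linear \<open>f\<close> below \<open>q\<close> has
  \<open>f (- y) \<le> - norm y\<close>. This replaces extension from the line through
  \<open>y\<close>.\<close>

lemma ex_real_functional:
  fixes y :: "'a::real_normed_vector"
  shows "\<exists>f. linear f \<and> (\<forall>x. \<bar>f x\<bar> \<le> norm x) \<and> f y = norm y"
proof -
  obtain q :: "'a \<Rightarrow> real" where q: "sublinear q" "\<forall>x. q x \<le> norm x" "q (- y) \<le> - norm y"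
    using sublinear_reduce[OF sublinear_norm] by blast
  obtain f where f: "linear f" "\<forall>x. f x \<le> q x"
    using sublinear_dominates_linear[OF q(1)] by blast
  have le: "f x \<le> norm x" for x
    using f(2) q(2) order_trans by blast
  have abs: "\<bar>f x\<bar> \<le> norm x" for x
    using le[of x] le[of "- x"] linear_neg[OF f(1), of x] by simp
  moreover have "f y = norm y"
    using f(2)[rule_format, of "- y"] q(3) linear_neg[OF f(1), of y] le[of y] by simp
  ultimately show ?thesis using f(1) by blast
qed

section \<open>Complex functionals separating points\<close>

lemma ex_cblinfun_functional:
  fixes y :: "'a::complex_normed_vector"
  assumes "y \<noteq> 0"
  shows "\<exists>\<phi> :: 'a \<Rightarrow>\<^sub>C\<^sub>L complex. \<phi> y = 1"
proof -
  obtain f where f: "linear f" "\<And>x. \<bar>f x\<bar> \<le> norm x" "f y = norm y"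
    using ex_real_functional[of y] by blast
  \<comment> \<open>The complex-linear functional with real part \<open>f\<close>; since
    \<open>f y = norm y\<close> it does not vanish at \<open>y\<close> and can be rescaled.\<close>
  define g where "g x = Complex (f x) (- f (\<i> *\<^sub>C x))" for x
  have cR: "c *\<^sub>C x = Re c *\<^sub>R x + Im c *\<^sub>R \<i> *\<^sub>C x" for c and x :: 'a
    by (simp add: scaleR_scaleC scaleC_scaleC mult.commute[of _ \<i>] flip: scaleC_add_left complex_eq)
  have fc: "f (c *\<^sub>C x) = Re c * f x + Im c * f (\<i> *\<^sub>C x)" for c x
    by (subst cR) (simp add: linear_add[OF f(1)] linear_scale[OF f(1)])
  have "\<exists>\<phi> :: 'a \<Rightarrow>\<^sub>C\<^sub>L complex. cblinfun_apply \<phi> = g"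
  proof (rule ex_cblinfun)
    show "g (x + x') = g x + g x'" for x x'
      by (simp add: g_def scaleC_add_right linear_add[OF f(1)] complex_eq_iff)
    show "g (c *\<^sub>C x) = c *\<^sub>C g x" for c x
      unfolding g_def scaleC_scaleC fc[of "\<i> * c"] fc[of c] by (simp add: complex_eq_iff scaleC_complex_def)
    \<comment> \<open>The constant 2 comes from bounding the modulus by the sum of the absolute
      values of real and imaginary part.\<close>
    show "norm (g x) \<le> 2 * norm x" for x
      using cmod_le[of "g x"] f(2)[of x] f(2)[of "\<i> *\<^sub>C x"] by (simp add: g_def norm_scaleC)
  qed
  then obtain \<phi> :: "'a \<Rightarrow>\<^sub>C\<^sub>L complex" where \<phi>: "cblinfun_apply \<phi> = g" by blast
  have "g y \<noteq> 0"
    using f(3) assms by (simp add: g_def complex_eq_iff)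
  then have "cblinfun_apply (inverse (g y) *\<^sub>C \<phi>) y = 1"
    by (simp add: scaleC_cblinfun_apply \<phi> scaleC_complex_def)
  then show ?thesis ..
qed

lemma cblinfun_functional_eq_0:
  fixes v :: "'a::complex_normed_vector"
  assumes "\<And>\<phi> :: 'a \<Rightarrow>\<^sub>C\<^sub>L complex. \<phi> v = 0"
  shows "v = 0"
  using ex_cblinfun_functional[of v] assms by force


section \<open>Approximation of scalar operators by operators of finite rank\<close>

text \<open>A basis of the domain is mapped injectively to an independent set inside a finitely
  spanned space, hence is finite.\<close>

lemma finite_dimensional_inj:
  fixes f :: "'a::complex_vector \<Rightarrow> 'b::complex_vector"
  assumes add: "\<And>x y. f (x + y) = f x + f y" and scale: "\<And>c x. f (c *\<^sub>C x) = c *\<^sub>C f x"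
    and inj: "\<And>x. f x = 0 \<Longrightarrow> x = 0" and fin: "finite_dimensional (range f)"
  shows "finite_dimensional (UNIV :: 'a set)"
proof -
  interpret vp: vector_space_pair "scaleC :: complex \<Rightarrow> 'a \<Rightarrow> 'a" "scaleC :: complex \<Rightarrow> 'b \<Rightarrow> 'b" ..
  have lin: "Vector_Spaces.linear scaleC scaleC f"
    by unfold_locales (simp_all add: add scale)
  have "inj f"
    using vp.linear_inj_iff_eq_0[OF lin] inj by blast
  obtain B :: "'a set" where B: "\<not> complex_vector.dependent B" "UNIV \<subseteq> cspan B"
    using complex_vector.maximal_independent_subset[of UNIV] by auto
  obtain F where F: "finite F" "range f \<subseteq> cspan F"
    using fin by (auto simp: finite_dimensional_def)
  have "\<not> complex_vector.dependent (f ` B)"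
    by (rule vp.linear_independent_injective_image[OF lin B(1)]) (use \<open>inj f\<close> in \<open>auto intro: inj_on_subset\<close>)
  moreover have "f ` B \<subseteq> cspan F" using F(2) by blast
  ultimately have "finite (f ` B)"
    using complex_vector.independent_span_bound[OF F(1)] by blast
  then have "finite B"
    using \<open>inj f\<close> by (auto dest: finite_imageD intro: inj_on_subset)
  with B(2) show ?thesis by (auto simp: finite_dimensional_def)
qed

text \<open>If \<open>e < cmod c\<close>, then \<open>F x = 0\<close> would give
  \<open>cmod c * norm x \<le> e * norm x\<close>, so \<open>x = 0\<close>. Thus \<open>F\<close>
  would embed an infinite-dimensional space into a finite-dimensional one.\<close>

lemma scalar_near_finite_rank:
  fixes F :: "'x::complex_normed_vector \<Rightarrow>\<^sub>C\<^sub>L 'x"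
  assumes inf: "\<not> finite_dimensional (UNIV :: 'x set)" and F: "finite_rank F"
    and near: "\<And>x. norm (c *\<^sub>C x - F x) \<le> e * norm x"
  shows "cmod c \<le> e"
proof (rule ccontr)
  assume e: "\<not> cmod c \<le> e"
  have "finite_dimensional (UNIV :: 'x set)"
  proof (rule finite_dimensional_inj[of "cblinfun_apply F"])
    show "x = 0" if "F x = 0" for x
    proof (rule ccontr)
      assume "x \<noteq> 0"
      then show False using near[of x] that e by (simp add: norm_scaleC)
    qed
    show "finite_dimensional (range (cblinfun_apply F))"
      using F by (simp add: finite_rank_def)
  qed (simp_all add: cblinfun_apply_add cblinfun_scaleC_right)
  with inf show False ..
qed


section \<open>Operators on the projective tensor product\<close>

lemmas elementary_tensor_simps = elementary_tensor_bilinear[unfolded bilinear_on_def, simplified]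

section \<open>Slice maps and rank-one operators\<close>

lemma ex_slice_left:
  fixes \<phi> :: "'a::complex_normed_vector \<Rightarrow>\<^sub>C\<^sub>L complex"
  shows "\<exists>V :: ('a, 'b::complex_banach) ptensor \<Rightarrow>\<^sub>C\<^sub>L 'b. \<forall>p q. cblinfun_apply V (p \<otimes>\<^sub>\<gamma> q) = \<phi> p *\<^sub>C q"
proof -
  have "\<exists>V :: ('a, 'b) ptensor \<Rightarrow>\<^sub>C\<^sub>L 'b. (\<forall>p q. cblinfun_apply V (p \<otimes>\<^sub>\<gamma> q) = \<phi> p *\<^sub>C q) \<and> norm V \<le> norm \<phi>"
  proof (rule ex_ptensor_lift)
    show "bilinear_on UNIV UNIV (\<lambda>p q. \<phi> p *\<^sub>C q :: 'b)"
      by (simp add: bilinear_on_def cblinfun_apply_add cblinfun_scaleC_right scaleC_add_left scaleC_add_right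
          scaleC_scaleC scaleC_complex_def mult.commute)
    show "norm (\<phi> p *\<^sub>C q) \<le> norm \<phi> * (norm p * norm q)" for p and q :: 'b
      using mult_right_mono[OF norm_cblinfun_apply[of \<phi> p], of "norm q"] by (simp add: norm_scaleC mult.assoc)
  qed simp
  then show ?thesis by blast
qed

lemma ex_slice_right:
  fixes \<psi> :: "'b::complex_normed_vector \<Rightarrow>\<^sub>C\<^sub>L complex"
  shows "\<exists>V :: ('a::complex_banach, 'b) ptensor \<Rightarrow>\<^sub>C\<^sub>L 'a. \<forall>p q. cblinfun_apply V (p \<otimes>\<^sub>\<gamma> q) = \<psi> q *\<^sub>C p"
proof -
  have "\<exists>V :: ('a, 'b) ptensor \<Rightarrow>\<^sub>C\<^sub>L 'a. (\<forall>p q. cblinfun_apply V (p \<otimes>\<^sub>\<gamma> q) = \<psi> q *\<^sub>C p) \<and> norm V \<le> norm \<psi>"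
  proof (rule ex_ptensor_lift)
    show "bilinear_on UNIV UNIV (\<lambda>p q. \<psi> q *\<^sub>C p :: 'a)"
      by (simp add: bilinear_on_def cblinfun_apply_add cblinfun_scaleC_right scaleC_add_left scaleC_add_right
          scaleC_scaleC scaleC_complex_def mult.commute)
    show "norm (\<psi> q *\<^sub>C p) \<le> norm \<psi> * (norm p * norm q)" for q and p :: 'a
      using mult_right_mono[OF norm_cblinfun_apply[of \<psi> q], of "norm p"]
      by (simp add: norm_scaleC mult.assoc mult.commute[of "norm p"])
  qed simp
  then show ?thesis by blast
qed

lemma ex_tensor_left:
  fixes \<xi> :: "'a::complex_normed_vector"
  shows "\<exists>L :: 'b::complex_normed_vector \<Rightarrow>\<^sub>C\<^sub>L ('a, 'b) ptensor. \<forall>q. L q = \<xi> \<otimes>\<^sub>\<gamma> q"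
  using ex_cblinfun[of "\<lambda>q :: 'b. \<xi> \<otimes>\<^sub>\<gamma> q" "norm \<xi>"]
  by (auto simp: elementary_tensor_simps norm_elementary_tensor_le fun_eq_iff)

text \<open>Supplies the elements of the algebra to which the hyper-commutator identity is
  applied.\<close>

lemma ex_rank_one:
  fixes \<phi> :: "'a::complex_normed_vector \<Rightarrow>\<^sub>C\<^sub>L complex" and \<xi> :: 'a
  shows "\<exists>c :: 'a \<Rightarrow>\<^sub>C\<^sub>L 'a. (\<forall>z. cblinfun_apply c z = \<phi> z *\<^sub>C \<xi>) \<and> finite_rank c"
proof -
  have "\<exists>c :: 'a \<Rightarrow>\<^sub>C\<^sub>L 'a. cblinfun_apply c = (\<lambda>z. \<phi> z *\<^sub>C \<xi>)"
  proof (rule ex_cblinfun)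
    show "norm (\<phi> z *\<^sub>C \<xi>) \<le> (norm \<phi> * norm \<xi>) * norm z" for z
      using mult_right_mono[OF norm_cblinfun_apply[of \<phi> z], of "norm \<xi>"]
      by (simp add: norm_scaleC mult.assoc mult.commute[of "norm \<xi>"])
  qed (simp_all add: cblinfun_apply_add cblinfun_scaleC_right scaleC_add_left scaleC_scaleC scaleC_complex_def)
  then obtain c :: "'a \<Rightarrow>\<^sub>C\<^sub>L 'a" where c: "cblinfun_apply c = (\<lambda>z. \<phi> z *\<^sub>C \<xi>)" by blast
  have "finite_rank c"
    unfolding finite_rank_def finite_dimensional_def c
    by (intro exI[of _ "{\<xi>}"]) (auto intro: complex_vector.span_scale complex_vector.span_base)
  with c show ?thesis by (intro exI[of _ c]) simp
qed

section \<open>Values of \<open>Upsilon\<close> on finite sums, and passage to limits\<close>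

lemma cblinfun_linear_extension:
  "cblinfun_apply T (linear_extension f u) = linear_extension (\<lambda>k. T (f k)) u"
  unfolding linear_extension_def linear_sum[OF bounded_linear.linear[OF bounded_linear_cblinfun_apply]]
  by (simp add: cblinfun_scaleC_right)

lemma linear_extension_apply:
  fixes f :: "'k \<Rightarrow> 'a::complex_normed_vector \<Rightarrow>\<^sub>C\<^sub>L 'b::complex_normed_vector"
  shows "cblinfun_apply (linear_extension f u) x = linear_extension (\<lambda>k. cblinfun_apply (f k) x) u"
proof -
  have "cblinfun_apply (\<Sum>k\<in>S. g k) x = (\<Sum>k\<in>S. cblinfun_apply (g k) x)" for S and g :: "'k \<Rightarrow> 'a \<Rightarrow>\<^sub>C\<^sub>L 'b"
    by (induction S rule: infinite_finite_induct) (simp_all add: cblinfun_apply_simps)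
  then show ?thesis by (simp add: linear_extension_def scaleC_cblinfun_apply)
qed

lemma Upsilon_formal:
  "Upsilon (ptensor_of_formal u) (x \<otimes>\<^sub>\<gamma> y) = linear_extension (\<lambda>(a, b). cblinfun_apply a x \<otimes>\<^sub>\<gamma> cblinfun_apply b y) u"
  unfolding ptensor_of_formal_linear_extension cblinfun_linear_extension linear_extension_apply
  by (simp add: case_prod_unfold Upsilon_elementary)

lemma ptensor_of_formal_map:
  "ptensor_of_formal (formal_map f g u) = linear_extension (\<lambda>(a, b). f a \<otimes>\<^sub>\<gamma> g b) u"
proof -
  have sum: "ptensor_of_formal (\<Sum>k\<in>S. v k) = (\<Sum>k\<in>S. ptensor_of_formal (v k))" for S v
    by (induction S rule: infinite_finite_induct)
      (simp_all add: ptensor_of_formal_add ptensor_of_formal_null tensor_null_0)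
  show ?thesis
    by (simp add: formal_map_def linear_extension_def sum ptensor_of_formal_scaleC elementary_tensor_def
        case_prod_unfold)
qed

text \<open>Agreement on the approximating finite sums passes to the limit by continuity. Two
  sequences are allowed because a module action changes the representing sequence.\<close>

lemma cblinfun_abs_ptensor_eqI:
  assumes s: "tensor_Cauchy UNIV UNIV s" and t: "tensor_Cauchy UNIV UNIV t"
    and eq: "\<And>n. cblinfun_apply F (ptensor_of_formal (s n)) = cblinfun_apply G (ptensor_of_formal (t n))"
  shows "F (abs_ptensor s) = G (abs_ptensor t)"
proof (rule LIMSEQ_unique)
  show "(\<lambda>n. F (ptensor_of_formal (s n))) \<longlonglongrightarrow> F (abs_ptensor s)"
    by (rule bounded_linear.tendsto[OF bounded_linear_cblinfun_apply ptensor_of_formal_tendsto[OF s]])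
  show "(\<lambda>n. F (ptensor_of_formal (s n))) \<longlonglongrightarrow> G (abs_ptensor t)"
    unfolding eq by (rule bounded_linear.tendsto[OF bounded_linear_cblinfun_apply ptensor_of_formal_tendsto[OF t]])
qed


text \<open>Packages evaluation at a fixed \<open>w\<close> as a bounded operator in
  \<open>m\<close>, so that the limit argument above applies to it.\<close>

lemma ex_Upsilon_eval:
  "\<exists>E :: ('x::complex_banach \<Rightarrow>\<^sub>C\<^sub>L 'x, 'x \<Rightarrow>\<^sub>C\<^sub>L 'x) ptensor \<Rightarrow>\<^sub>C\<^sub>L ('x, 'x) ptensor.
    \<forall>m. cblinfun_apply E m = cblinfun_apply (cblinfun_apply Upsilon m) w"
proof -
  have "\<exists>E :: ('x \<Rightarrow>\<^sub>C\<^sub>L 'x, 'x \<Rightarrow>\<^sub>C\<^sub>L 'x) ptensor \<Rightarrow>\<^sub>C\<^sub>L ('x, 'x) ptensor.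
      cblinfun_apply E = (\<lambda>m. cblinfun_apply (cblinfun_apply Upsilon m) w)"
  proof (rule ex_cblinfun)
    fix m :: "('x \<Rightarrow>\<^sub>C\<^sub>L 'x, 'x \<Rightarrow>\<^sub>C\<^sub>L 'x) ptensor"
    have "norm (Upsilon m w) \<le> norm (Upsilon m) * norm w"
      by (rule norm_cblinfun_apply)
    also have "\<dots> \<le> (norm (Upsilon :: ('x \<Rightarrow>\<^sub>C\<^sub>L 'x, 'x \<Rightarrow>\<^sub>C\<^sub>L 'x) ptensor \<Rightarrow>\<^sub>C\<^sub>L _) * norm m) * norm w"
      by (intro mult_right_mono norm_cblinfun_apply) simp
    finally show "norm (Upsilon m w) \<le>
        (norm (Upsilon :: ('x \<Rightarrow>\<^sub>C\<^sub>L 'x, 'x \<Rightarrow>\<^sub>C\<^sub>L 'x) ptensor \<Rightarrow>\<^sub>C\<^sub>L _) * norm w) * norm m"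
      by (simp add: mult_ac)
  qed (simp_all add: cblinfun_apply_add cblinfun_scaleC_right cblinfun_apply_simps scaleC_cblinfun_apply)
  then show ?thesis by (auto simp: fun_eq_iff)
qed

section \<open>The hyper-commutator identity for the image operator\<close>

text \<open>\<open>L\<close> is \<open>c\<close> tensored with the identity. On a term
  \<open>a\<close>, \<open>b\<close> of a finite sum, the left action by \<open>c\<close> leads to
  \<open>c (a x) \<otimes>\<^sub>\<gamma> b y\<close> and the right action to
  \<open>a x \<otimes>\<^sub>\<gamma> b (c y)\<close>; both sides extend by continuity.\<close>

lemma hyper_commutator_intertwines:
  fixes A :: "('x::complex_banach \<Rightarrow>\<^sub>C\<^sub>L 'x) set"
  assumes A: "banach_subalgebra A" and M: "hyper_commutator A M" and c: "c \<in> A"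
    and L: "\<And>p q. cblinfun_apply L (p \<otimes>\<^sub>\<gamma> q) = cblinfun_apply c p \<otimes>\<^sub>\<gamma> q"
  shows "cblinfun_apply L (Upsilon (ptensor_inclusion M) (x \<otimes>\<^sub>\<gamma> y)) = Upsilon (ptensor_inclusion M) (x \<otimes>\<^sub>\<gamma> c y)"
proof -
  have S: "csubspace A" using A by (simp add: banach_subalgebra_def)
  obtain s where M_s: "M = ptensor_class A A s" and s: "tensor_Cauchy A A s"
    using M by (auto simp: hyper_commutator_def ptensor_space_def)
  let ?l = "\<lambda>n. formal_map (\<lambda>a. c o\<^sub>C\<^sub>L a) id (s n)" and ?r = "\<lambda>n. formal_map id (\<lambda>b. b o\<^sub>C\<^sub>L c) (s n)"
  have closed: "(\<lambda>a. c o\<^sub>C\<^sub>L a) ` A \<subseteq> A" "(\<lambda>b. b o\<^sub>C\<^sub>L c) ` A \<subseteq> A" "id ` A \<subseteq> A"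
    using A c by (auto simp: banach_subalgebra_def)
  note l = ptensor_inclusion_class[OF S
      ptensor_rel_formal_map(1)[OF S S bounded_clinear_compose_left closed(1) bounded_clinear_id closed(3) s]]
  note r = ptensor_inclusion_class[OF S
      ptensor_rel_formal_map(1)[OF S S bounded_clinear_id closed(3) bounded_clinear_compose_right closed(2) s]]
  note s' = ptensor_inclusion_class[OF S s]
  have "ptensor_class A A ?l = ptensor_class A A ?r"
    using M c action_class(1,2)[OF A c s] by (simp add: hyper_commutator_def M_s)
  \<comment> \<open>Equality of the classes over \<open>A\<close> passes to the larger tensor
    product on applying \<open>ptensor_inclusion\<close>.\<close>
  then have lr: "abs_ptensor ?l = abs_ptensor ?r"
    using l(2) r(2) by simp
  obtain E :: "('x \<Rightarrow>\<^sub>C\<^sub>L 'x, 'x \<Rightarrow>\<^sub>C\<^sub>L 'x) ptensor \<Rightarrow>\<^sub>C\<^sub>L ('x, 'x) ptensor"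
    where E: "\<And>m. cblinfun_apply E m = Upsilon m (x \<otimes>\<^sub>\<gamma> y)"
    using ex_Upsilon_eval by blast
  obtain E' :: "('x \<Rightarrow>\<^sub>C\<^sub>L 'x, 'x \<Rightarrow>\<^sub>C\<^sub>L 'x) ptensor \<Rightarrow>\<^sub>C\<^sub>L ('x, 'x) ptensor"
    where E': "\<And>m. cblinfun_apply E' m = Upsilon m (x \<otimes>\<^sub>\<gamma> c y)"
    using ex_Upsilon_eval by blast
  have map: "E (ptensor_of_formal (formal_map f g u)) = linear_extension (\<lambda>(a, b). cblinfun_apply (f a) x \<otimes>\<^sub>\<gamma> cblinfun_apply (g b) y) u" for f g u
    unfolding ptensor_of_formal_map cblinfun_linear_extension
    by (simp add: case_prod_unfold E Upsilon_elementary)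
  have "(L o\<^sub>C\<^sub>L E) (abs_ptensor s) = E (abs_ptensor ?l)"
    by (rule cblinfun_abs_ptensor_eqI[OF s'(1) l(1)])
      (unfold map, simp add: cblinfun_compose_apply E Upsilon_formal cblinfun_linear_extension case_prod_unfold L)
  also have "\<dots> = E' (abs_ptensor s)"
    unfolding lr
    by (rule cblinfun_abs_ptensor_eqI[OF r(1) s'(1)])
      (unfold map, simp add: cblinfun_compose_apply E' Upsilon_formal case_prod_unfold)
  finally show ?thesis
    by (simp add: M_s s'(2) cblinfun_compose_apply E E')
qed

section \<open>Slices of the image as limits of finite-rank operators\<close>

text \<open>With \<open>x\<close> fixed, the first tensor factors are the finitely many vectors
  \<open>a x\<close> with \<open>(a, b)\<close> a key of \<open>u\<close>. They span the range of
  the slice even when \<open>a\<close> and \<open>b\<close> have infinite rank.\<close>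

lemma finite_rank_slice:
  fixes u :: "('x::complex_banach \<Rightarrow>\<^sub>C\<^sub>L 'x, 'x \<Rightarrow>\<^sub>C\<^sub>L 'x) formal_sum"
  assumes V: "\<And>p q. cblinfun_apply V (p \<otimes>\<^sub>\<gamma> q) = cblinfun_apply \<psi> q *\<^sub>C p"
    and F: "\<And>z. cblinfun_apply F z = cblinfun_apply V (Upsilon (ptensor_of_formal u) (x \<otimes>\<^sub>\<gamma> z))"
  shows "finite_rank F"
proof -
  let ?B = "(\<lambda>(a, b). cblinfun_apply a x) ` Poly_Mapping.keys u"
  have "F z \<in> cspan ?B" for z
  proof -
    have "F z = (\<Sum>k\<in>Poly_Mapping.keys u. Poly_Mapping.lookup u k *\<^sub>C \<psi> (cblinfun_apply (snd k) z) *\<^sub>C cblinfun_apply (fst k) x)"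
      unfolding F Upsilon_formal cblinfun_linear_extension
      by (simp add: linear_extension_def case_prod_unfold V)
    also have "\<dots> \<in> cspan ?B"
      by (intro complex_vector.span_sum complex_vector.span_scale complex_vector.span_base)
        (auto simp: case_prod_unfold)
    finally show ?thesis .
  qed
  then show ?thesis
    unfolding finite_rank_def finite_dimensional_def by (intro exI[of _ ?B]) auto
qed

text \<open>Replacing the limit by \<open>s n\<close> turns the slice into a finite-rank operator.
  The error is controlled by \<open>norm (d n)\<close>, so \<open>cmod c\<close> is bounded by a
  null sequence.\<close>

lemma scalar_slice_eq_0:
  fixes s :: "nat \<Rightarrow> ('x::complex_banach \<Rightarrow>\<^sub>C\<^sub>L 'x, 'x \<Rightarrow>\<^sub>C\<^sub>L 'x) formal_sum"
  assumes inf: "\<not> finite_dimensional (UNIV :: 'x set)" and s: "tensor_Cauchy UNIV UNIV s"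
    and V: "\<And>p q. cblinfun_apply V (p \<otimes>\<^sub>\<gamma> q) = cblinfun_apply \<psi> q *\<^sub>C p"
    and scalar: "\<And>z. cblinfun_apply V (Upsilon (abs_ptensor s) (x \<otimes>\<^sub>\<gamma> z)) = c *\<^sub>C z"
  shows "c = 0"
proof -
  obtain T :: "'x \<Rightarrow>\<^sub>C\<^sub>L ('x, 'x) ptensor" where T: "\<And>z. cblinfun_apply T z = x \<otimes>\<^sub>\<gamma> z"
    using ex_tensor_left by blast
  define U where "U = (Upsilon :: ('x \<Rightarrow>\<^sub>C\<^sub>L 'x, 'x \<Rightarrow>\<^sub>C\<^sub>L 'x) ptensor \<Rightarrow>\<^sub>C\<^sub>L _)"
  define d where "d n = abs_ptensor s - ptensor_of_formal (s n)" for n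
  have le: "cmod c \<le> norm V * (norm U * norm (d n) * norm T)" for n
  proof (rule scalar_near_finite_rank[OF inf])
    let ?F = "V o\<^sub>C\<^sub>L U (ptensor_of_formal (s n)) o\<^sub>C\<^sub>L T"
    show "finite_rank ?F"
      by (rule finite_rank_slice[OF V]) (simp add: cblinfun_compose_apply T U_def)
    fix z
    have "c *\<^sub>C z - ?F z = (V o\<^sub>C\<^sub>L (U (d n) o\<^sub>C\<^sub>L T)) z"
      by (simp add: cblinfun_compose_apply T U_def d_def flip: scalar)
        (simp add: cblinfun_apply_simps linear_diff[OF bounded_linear.linear[OF bounded_linear_cblinfun_apply]])
    also have "norm \<dots> \<le> norm (V o\<^sub>C\<^sub>L (U (d n) o\<^sub>C\<^sub>L T)) * norm z"
      by (rule norm_cblinfun_apply)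
    also have "\<dots> \<le> norm V * (norm U * norm (d n) * norm T) * norm z"
      by (intro mult_right_mono order_trans[OF norm_cblinfun_compose] mult_left_mono
          order_trans[OF norm_cblinfun_compose] norm_cblinfun_apply) auto
    finally show "norm (c *\<^sub>C z - ?F z) \<le> norm V * (norm U * norm (d n) * norm T) * norm z" .
  qed
  have "d \<longlonglongrightarrow> 0"
    using tendsto_diff[OF tendsto_const ptensor_of_formal_tendsto[OF s], of "abs_ptensor s"]
    by (simp add: d_def[abs_def])
  then have "(\<lambda>n. norm V * (norm U * norm (d n) * norm T)) \<longlonglongrightarrow> 0"
    by (intro tendsto_mult_right_zero tendsto_mult_left_zero tendsto_norm_zero)
  then have "cmod c \<le> 0"
    by (rule LIMSEQ_le_const) (use le in auto)
  then show ?thesis by simp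
qed

section \<open>Vanishing of the image on elementary tensors\<close>

theorem theorem3p7:
  fixes A :: "('x::complex_banach \<Rightarrow>\<^sub>C\<^sub>L 'x) set"
    and M :: "(nat \<Rightarrow> ('x \<Rightarrow>\<^sub>C\<^sub>L 'x, 'x \<Rightarrow>\<^sub>C\<^sub>L 'x) formal_sum) set"
  assumes "\<not> finite_dimensional (UNIV :: 'x set)"
    and "banach_subalgebra A"
    and "{T. finite_rank T} \<subseteq> A"
    and "M \<in> ptensor_space A A"
    and "hyper_commutator A M"
  shows "cblinfun_apply Upsilon (ptensor_inclusion M) = 0"
proof (rule cblinfun_ptensor_eqI)
  fix x \<xi> :: 'x
  let ?W = "cblinfun_apply Upsilon (ptensor_inclusion M)"
  have S: "csubspace A" using assms(2) by (simp add: banach_subalgebra_def)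
  obtain s where "M = ptensor_class A A s" "tensor_Cauchy A A s"
    using assms(4) by (auto simp: ptensor_space_def)
  then have s: "ptensor_inclusion M = abs_ptensor s" "tensor_Cauchy UNIV UNIV s"
    using ptensor_inclusion_class[OF S] by auto
  \<comment> \<open>Were every vector zero, the empty set would span the space.\<close>
  obtain y :: 'x where "y \<noteq> 0"
    using assms(1) complex_vector.span_zero[of "{}"] unfolding finite_dimensional_def
    by (metis finite.emptyI subsetI)
  then obtain \<phi> :: "'x \<Rightarrow>\<^sub>C\<^sub>L complex" where \<phi>: "\<phi> y = 1"
    using ex_cblinfun_functional by blast
  obtain R :: "('x, 'x) ptensor \<Rightarrow>\<^sub>C\<^sub>L 'x" where R: "\<And>p q. cblinfun_apply R (p \<otimes>\<^sub>\<gamma> q) = \<phi> p *\<^sub>C q"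
    using ex_slice_left by blast
  \<comment> \<open>With \<open>y\<close> and \<open>\<phi>\<close> fixed, \<open>v\<close> depends
    only on \<open>x\<close>.\<close>
  define v where "v = R (?W (x \<otimes>\<^sub>\<gamma> y))"
  have W: "?W (x \<otimes>\<^sub>\<gamma> z) = z \<otimes>\<^sub>\<gamma> v" for z
  proof -
    \<comment> \<open>This \<open>c\<close> sends \<open>y\<close> to \<open>z\<close> because
      \<open>\<phi> y = 1\<close>. Tensored with the identity it factors as
      \<open>T o\<^sub>C\<^sub>L R\<close>: slice by \<open>\<phi>\<close>, then tensor with
      \<open>z\<close> on the left.\<close>
    obtain c :: "'x \<Rightarrow>\<^sub>C\<^sub>L 'x" where c: "\<And>p. cblinfun_apply c p = \<phi> p *\<^sub>C z" and "finite_rank c"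
      using ex_rank_one by blast
    with assms(3) have "c \<in> A" by blast
    obtain T :: "'x \<Rightarrow>\<^sub>C\<^sub>L ('x, 'x) ptensor" where T: "\<And>q. cblinfun_apply T q = z \<otimes>\<^sub>\<gamma> q"
      using ex_tensor_left by blast
    have "(T o\<^sub>C\<^sub>L R) (?W (x \<otimes>\<^sub>\<gamma> y)) = ?W (x \<otimes>\<^sub>\<gamma> c y)"
      by (rule hyper_commutator_intertwines[OF assms(2,5) \<open>c \<in> A\<close>])
        (simp add: cblinfun_compose_apply R T c elementary_tensor_simps)
    then show ?thesis
      by (simp add: cblinfun_compose_apply T v_def c \<phi> scaleC_one)
  qed
  have "v = 0"
  proof (rule cblinfun_functional_eq_0)
    fix \<psi> :: "'x \<Rightarrow>\<^sub>C\<^sub>L complex"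
    obtain V :: "('x, 'x) ptensor \<Rightarrow>\<^sub>C\<^sub>L 'x" where V: "\<And>p q. cblinfun_apply V (p \<otimes>\<^sub>\<gamma> q) = \<psi> q *\<^sub>C p"
      using ex_slice_right by blast
    \<comment> \<open>By \<open>W\<close>, slicing the second factor by \<open>\<psi>\<close> gives
      the scalar operator \<open>z \<mapsto> \<psi> v *\<^sub>C z\<close>.\<close>
    show "\<psi> v = 0"
      by (rule scalar_slice_eq_0[OF assms(1) s(2) V, of x]) (simp add: W V flip: s(1))
  qed
  \<comment> \<open>Homogeneity with the scalar 0 shows that tensoring with the zero vector gives
    zero.\<close>
  moreover have "\<xi> \<otimes>\<^sub>\<gamma> (0 *\<^sub>C v) = 0 *\<^sub>C (\<xi> \<otimes>\<^sub>\<gamma> v)"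
    using elementary_tensor_simps by blast
  ultimately show "?W (x \<otimes>\<^sub>\<gamma> \<xi>) = cblinfun_apply 0 (x \<otimes>\<^sub>\<gamma> \<xi>)"
    by (simp add: W cblinfun_apply_simps)
qed

end
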